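(* Consider the four-parameter bond percolation model in a random layered environment on the semi-oriented graph $\vec{\mathbb{O}}_h$ described in the context, with parameters $\delta, p_g, p_b, p_h$. Let $\delta\in(0,1]$ and $p_h\in[0,\tfrac12)$, and let $\chi(p_h)$ be the expected number of vertices connected to the origin in independent (unoriented, nearest-neighbour) bond percolation on $\mathbb{Z}^2$ with parameter $p_h$. If $p_b\in\bigl(0,\tfrac{\delta^2}{16\,\chi(p_h)}\bigr)$, then for every $p_g\in[p_b,1]$ (including $p_g=1$), $$\mathbb{P}_{\delta,p_g,p_b,p_h}(0\to\infty)=0.$$
   Context: Vertex set: let $\vec u_1=(1,0,0)$, $\vec u_2=(0,1,0)$, $\vec u_3=(\tfrac12,\tfrac12,\tfrac1{\sqrt2})$ in $\mathbb{R}^3$ and $\mathbb{H}=\{a_1\vec u_1+a_2\vec u_2+a_3\vec u_3:\ a_1,a_2\in\mathbb{Z},\ a_3\in\mathbb{Z}_+\}$, where $\mathbb{Z}_+=\{0,1,2,\dots\}$. For $n\in\mathbb{Z}_+$ the layer of height $n$ is $\mathbb{H}_n=\{a_1\vec u_1+a_2\vec u_2+n\vec u_3:\ a_1,a_2\in\mathbb{Z}\}$. For $v\in\mathbb{H}_n$ let $\Gamma^+(v)=\{v+\vec u_3,\ v+\vec u_3-\vec u_1,\ v+\vec u_3-\vec u_2,\ v+\vec u_3-\vec u_1-\vec u_2\}\subset\mathbb{H}_{n+1}$. Graph $\vec{\mathbb{O}}_h$: it has vertex set $\mathbb{H}$ and two kinds of edges: upward oriented edges from $v$ to each $w\in\Gamma^+(v)$,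 for every $v\in\mathbb{H}$; and unoriented horizontal edges joining $v$ to $v\pm\vec u_1$ and $v\pm\vec u_2$, for every $v\in\mathbb{H}$ (so each layer with its horizontal edges is a copy of $\mathbb{Z}^2$). Model with parameters $\delta,p_b,p_g,p_h\in[0,1]$, $p_g\ge p_b$: each layer $\mathbb{H}_n$ is, independently of the others, bad with probability $\delta$ and good with probability $1-\delta$. Conditionally on the types of the layers, all edges are open or closed independently: an upward edge from $v\in\mathbb{H}_n$ to $w\in\Gamma^+(v)$ is open with probability $p_b$ if $\mathbb{H}_n$ is bad and with probability $p_g$ if $\mathbb{H}_n$ is good; each horizontal edge is open with probability $p_h$. $\mathbb{P}_{\delta,p_g,p_b,p_h}$ denotes the joint law of the layer types and the edge states. The event $\{0\to\infty\}$: there is an infinite sequence of distinct vertices $v_0=0,v_1,v_2,\dots$ such that for every $n\ge1$, $\langle v_{n-1},v_n\rangle$ is an open edge (upward edges are traversed only in their direction, horizontal edges in either direction). *)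

theory Defs
  imports "HOL-Probability.Probability"
begin

text \<open>
  A site \<open>((a, b), n)\<close> stands for the point \<open>a u1 + b u2 + n u3\<close> of \<open>\<real>\<^sup>3\<close>; the lemmas
  \<open>inj_point\<close>, \<open>point_up_nbrs\<close> and \<open>point_flat_nbrs\<close> confirm that the combinatorial
  neighbourhoods below are the geometric ones.
\<close>

type_synonym site = "(int \<times> int) \<times> nat"

definition u1 :: "real^3" where "u1 = vector [1, 0, 0]"
definition u2 :: "real^3" where "u2 = vector [0, 1, 0]"
definition u3 :: "real^3" where "u3 = vector [1/2, 1/2, 1 / sqrt 2]"

fun point :: "site \<Rightarrow> real^3" where
  "point ((a, b), n) = of_int a *\<^sub>R u1 + of_int b *\<^sub>R u2 + of_nat n *\<^sub>R u3"

abbreviation origin :: site where "origin \<equiv> ((0, 0), 0)"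

fun z2_nbrs :: "int \<times> int \<Rightarrow> (int \<times> int) set" where
  "z2_nbrs (a, b) = {(a + 1, b), (a - 1, b), (a, b + 1), (a, b - 1)}"

fun flat_nbrs :: "site \<Rightarrow> site set" where
  "flat_nbrs (x, n) = (\<lambda>y. (y, n)) ` z2_nbrs x"

fun up_nbrs :: "site \<Rightarrow> site set" where
  "up_nbrs ((a, b), n) =
     {((a, b), n + 1), ((a - 1, b), n + 1), ((a, b - 1), n + 1), ((a - 1, b - 1), n + 1)}"

lemma inj_point: "inj point"
proof (rule injI)
  fix v w :: site
  assume eq: "point v = point w"
  obtain a b n where v: "v = ((a, b), n)" by (metis prod.exhaust)
  obtain a' b' n' where w: "w = ((a', b'), n')" by (metis prod.exhaust)
  have "point v $ i = point w $ i" for i using eq by simp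
  from this[of 1] this[of 2] this[of 3] show "v = w"
    by (simp add: v w u1_def u2_def u3_def)
qed

lemma point_up_nbrs:
  "point ` up_nbrs v = {point v + u3, point v + u3 - u1, point v + u3 - u2, point v + u3 - u1 - u2}"
  by (cases v rule: up_nbrs.cases) (simp add: algebra_simps)

lemma point_flat_nbrs:
  "point ` flat_nbrs v = {point v + u1, point v - u1, point v + u2, point v - u2}"
proof -
  obtain a b n where v: "v = ((a, b), n)" by (metis prod.exhaust)
  show ?thesis by (simp add: v algebra_simps)
qed

text \<open>
  A horizontal edge is indexed by its unordered pair of end points, so that it carries a
  single state, whichever way it is traversed.
\<close>

datatype edge = Up site site | Flat "site set"

definition edges :: "edge set" where
  "edges = {Up v w | v w. w \<in> up_nbrs v} \<union> {Flat {v, w} | v w. w \<in> flat_nbrs v}"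

text \<open>Layer \<open>n\<close> is bad iff \<open>\<eta> n\<close>; edge \<open>e\<close> is open iff \<open>\<omega> e\<close>.\<close>

abbreviation layer_space :: "(nat \<Rightarrow> bool) measure" where
  "layer_space \<equiv> PiM UNIV (\<lambda>_. count_space UNIV)"

abbreviation edge_space :: "(edge \<Rightarrow> bool) measure" where
  "edge_space \<equiv> PiM edges (\<lambda>_. count_space UNIV)"

fun open_prob :: "real \<Rightarrow> real \<Rightarrow> real \<Rightarrow> (nat \<Rightarrow> bool) \<Rightarrow> edge \<Rightarrow> real" where
  "open_prob p_g p_b p_h \<eta> (Up v w) = (if \<eta> (snd v) then p_b else p_g)"
| "open_prob p_g p_b p_h \<eta> (Flat _) = p_h"

definition layer_law :: "real \<Rightarrow> (nat \<Rightarrow> bool) measure" where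
  "layer_law \<delta> = PiM UNIV (\<lambda>_. measure_pmf (bernoulli_pmf \<delta>))"

definition edge_law :: "real \<Rightarrow> real \<Rightarrow> real \<Rightarrow> (nat \<Rightarrow> bool) \<Rightarrow> (edge \<Rightarrow> bool) measure" where
  "edge_law p_g p_b p_h \<eta> =
     PiM edges (\<lambda>e. measure_pmf (bernoulli_pmf (open_prob p_g p_b p_h \<eta> e)))"

definition perc_law ::
    "real \<Rightarrow> real \<Rightarrow> real \<Rightarrow> real \<Rightarrow> ((nat \<Rightarrow> bool) \<times> (edge \<Rightarrow> bool)) measure" where
  "perc_law \<delta> p_g p_b p_h =
     layer_law \<delta> \<bind> (\<lambda>\<eta>. edge_law p_g p_b p_h \<eta> \<bind>
       (\<lambda>\<omega>. return (layer_space \<Otimes>\<^sub>M edge_space) (\<eta>, \<omega>)))"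

definition open_step :: "(edge \<Rightarrow> bool) \<Rightarrow> site \<Rightarrow> site \<Rightarrow> bool" where
  "open_step \<omega> v w \<longleftrightarrow> w \<in> up_nbrs v \<and> \<omega> (Up v w) \<or> w \<in> flat_nbrs v \<and> \<omega> (Flat {v, w})"

definition percolates :: "(edge \<Rightarrow> bool) \<Rightarrow> bool" where
  "percolates \<omega> \<longleftrightarrow> (\<exists>v :: nat \<Rightarrow> site. v 0 = origin \<and> inj v \<and> (\<forall>n. open_step \<omega> (v n) (v (Suc n))))"

definition z2_edges :: "(int \<times> int) set set" where
  "z2_edges = {{x, y} | x y. y \<in> z2_nbrs x}"

definition z2_law :: "real \<Rightarrow> ((int \<times> int) set \<Rightarrow> bool) measure" where
  "z2_law p = PiM z2_edges (\<lambda>_. measure_pmf (bernoulli_pmf p))"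

definition z2_cluster :: "((int \<times> int) set \<Rightarrow> bool) \<Rightarrow> (int \<times> int) set" where
  "z2_cluster \<omega> = {y. (\<lambda>x y. y \<in> z2_nbrs x \<and> \<omega> {x, y})\<^sup>*\<^sup>* (0, 0) y}"

text \<open>
  The cluster size is a counting measure, hence \<open>\<infinity>\<close> for an infinite cluster, and \<open>\<chi>(p)\<close> is an
  extended nonnegative real.
\<close>

definition chi :: "real \<Rightarrow> ennreal" where
  "chi p = (\<integral>\<^sup>+ \<omega>. emeasure (count_space UNIV) (z2_cluster \<omega>) \<partial>z2_law p)"

lemma space_layer_law [simp]: "space (layer_law \<delta>) = UNIV"
  by (simp add: layer_law_def space_PiM PiE_def)

lemma sets_layer_law [measurable_cong]: "sets (layer_law \<delta>) = sets layer_space"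
  unfolding layer_law_def by (intro sets_PiM_cong) simp_all

lemma sets_edge_law [measurable_cong]: "sets (edge_law p_g p_b p_h \<eta>) = sets edge_space"
  unfolding edge_law_def by (intro sets_PiM_cong) simp_all

lemma sets_z2_law [measurable_cong]: "sets (z2_law p) = sets (PiM z2_edges (\<lambda>_. count_space UNIV))"
  unfolding z2_law_def by (intro sets_PiM_cong) simp_all

lemma prob_space_layer_law: "prob_space (layer_law \<delta>)"
  unfolding layer_law_def by (intro prob_space_PiM prob_space_measure_pmf)

lemma prob_space_edge_law: "prob_space (edge_law p_g p_b p_h \<eta>)"
  unfolding edge_law_def by (intro prob_space_PiM prob_space_measure_pmf)

lemma prob_space_z2_law: "prob_space (z2_law p)"
  unfolding z2_law_def by (intro prob_space_PiM prob_space_measure_pmf)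

lemma measurable_edge_law [measurable]:
  "edge_law p_g p_b p_h \<in> layer_space \<rightarrow>\<^sub>M subprob_algebra edge_space"
proof (rule measurable_subprob_algebra_generated[where \<Omega> = "\<Pi>\<^sub>E e\<in>edges. UNIV"
        and G = "prod_algebra edges (\<lambda>_. count_space UNIV)"])
  show "sets edge_space = sigma_sets (\<Pi>\<^sub>E e\<in>edges. UNIV) (prod_algebra edges (\<lambda>_. count_space UNIV))"
    by (simp add: sets_PiM)
  show "Int_stable (prod_algebra edges (\<lambda>_. count_space (UNIV :: bool set)))"
    by (rule Int_stable_prod_algebra)
  show "prod_algebra edges (\<lambda>_. count_space UNIV) \<subseteq> Pow (\<Pi>\<^sub>E e\<in>edges. (UNIV :: bool set))"
    using prod_algebra_sets_into_space[of edges "\<lambda>_. count_space (UNIV :: bool set)"] by simp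
  show "subprob_space (edge_law p_g p_b p_h \<eta>)" for \<eta>
    by (intro prob_space_imp_subprob_space prob_space_edge_law)
  show "sets (edge_law p_g p_b p_h \<eta>) = sets edge_space" for \<eta>
    by (rule sets_edge_law)
  have b: "(\<lambda>\<eta>. emeasure (measure_pmf (bernoulli_pmf (open_prob p_g p_b p_h \<eta> e))) B)
      \<in> borel_measurable layer_space" for e B
  proof (cases e)
    case (Up v w)
    have "(\<lambda>\<eta>. if \<eta> (snd v) then emeasure (measure_pmf (bernoulli_pmf p_b)) B
        else emeasure (measure_pmf (bernoulli_pmf p_g)) B) \<in> borel_measurable layer_space"
      by measurable
    also have "(\<lambda>\<eta>. if \<eta> (snd v) then emeasure (measure_pmf (bernoulli_pmf p_b)) B
        else emeasure (measure_pmf (bernoulli_pmf p_g)) B)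
      = (\<lambda>\<eta>. emeasure (measure_pmf (bernoulli_pmf (open_prob p_g p_b p_h \<eta> e))) B)"
      using Up by auto
    finally show ?thesis .
  qed simp
  show "(\<lambda>\<eta>. emeasure (edge_law p_g p_b p_h \<eta>) A) \<in> borel_measurable layer_space"
    if A: "A \<in> prod_algebra edges (\<lambda>_. count_space UNIV)" for A
  proof -
    from A obtain J X where J: "A = prod_emb edges (\<lambda>_. count_space UNIV) J (Pi\<^sub>E J X)"
      "finite J" "J \<subseteq> edges" by (auto elim!: prod_algebraE)
    have "emeasure (edge_law p_g p_b p_h \<eta>) A
        = (\<Prod>e\<in>J. emeasure (measure_pmf (bernoulli_pmf (open_prob p_g p_b p_h \<eta> e))) (X e))" for \<eta>
    proof -
      have "A = prod_emb edges (\<lambda>e. measure_pmf (bernoulli_pmf (open_prob p_g p_b p_h \<eta> e))) J (Pi\<^sub>E J X)"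
        using J by (simp add: prod_emb_def)
      then show ?thesis
        unfolding edge_law_def using J
        by (simp add: emeasure_PiM_emb prob_space_measure_pmf)
    qed
    then show ?thesis using b by simp
  qed
  show "(\<lambda>\<eta>. emeasure (edge_law p_g p_b p_h \<eta>) (\<Pi>\<^sub>E e\<in>edges. UNIV)) \<in> borel_measurable layer_space"
  proof -
    have "(\<Pi>\<^sub>E e\<in>edges. UNIV) = space (edge_law p_g p_b p_h \<eta>)" for \<eta>
      by (simp add: edge_law_def space_PiM)
    then have "emeasure (edge_law p_g p_b p_h \<eta>) (\<Pi>\<^sub>E e\<in>edges. UNIV) = 1" for \<eta>
      using prob_space.emeasure_space_1[OF prob_space_edge_law] by metis
    then show ?thesis by simp
  qed
qed

lemma space_edge_law: "space (edge_law p_g p_b p_h \<eta>) = space edge_space"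
  by (rule sets_eq_imp_space_eq) (rule sets_edge_law)

lemma sets_perc_law [measurable_cong]:
  "sets (perc_law \<delta> p_g p_b p_h) = sets (layer_space \<Otimes>\<^sub>M edge_space)"
proof -
  have ne: "space edge_space \<noteq> {}" by (simp add: space_PiM PiE_eq_empty_iff)
  show ?thesis
    unfolding perc_law_def
    by (subst sets_bind[where N = "layer_space \<Otimes>\<^sub>M edge_space"])
       (auto simp: space_edge_law ne intro!: sets_bind)
qed

lemma emeasure_perc_law:
  assumes [measurable]: "A \<in> sets (layer_space \<Otimes>\<^sub>M edge_space)"
  shows "emeasure (perc_law \<delta> p_g p_b p_h) A =
    (\<integral>\<^sup>+ \<eta>. emeasure (edge_law p_g p_b p_h \<eta>) {\<omega> \<in> space edge_space. (\<eta>, \<omega>) \<in> A} \<partial>layer_law \<delta>)"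
proof -
  have ne: "space edge_space \<noteq> {}" by (simp add: space_PiM PiE_eq_empty_iff)
  have k [measurable]: "edge_law p_g p_b p_h \<in> layer_law \<delta> \<rightarrow>\<^sub>M subprob_algebra edge_space"
    by measurable
  have [simp]: "space layer_space = UNIV" by (simp add: space_PiM PiE_def)
  have "emeasure (perc_law \<delta> p_g p_b p_h) A =
    (\<integral>\<^sup>+ \<eta>. emeasure (edge_law p_g p_b p_h \<eta> \<bind>
       (\<lambda>\<omega>. return (layer_space \<Otimes>\<^sub>M edge_space) (\<eta>, \<omega>))) A \<partial>layer_law \<delta>)"
    unfolding perc_law_def
    by (rule emeasure_bind[where N = "layer_space \<Otimes>\<^sub>M edge_space"]) simp_all
  also have "\<dots> = (\<integral>\<^sup>+ \<eta>. emeasure (edge_law p_g p_b p_h \<eta>)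
      {\<omega> \<in> space edge_space. (\<eta>, \<omega>) \<in> A} \<partial>layer_law \<delta>)"
  proof (rule nn_integral_cong)
    fix \<eta>
    have "emeasure (edge_law p_g p_b p_h \<eta> \<bind> (\<lambda>\<omega>. return (layer_space \<Otimes>\<^sub>M edge_space) (\<eta>, \<omega>))) A
      = (\<integral>\<^sup>+ \<omega>. emeasure (return (layer_space \<Otimes>\<^sub>M edge_space) (\<eta>, \<omega>)) A \<partial>edge_law p_g p_b p_h \<eta>)"
      by (rule emeasure_bind[where N = "layer_space \<Otimes>\<^sub>M edge_space"])
         (simp_all add: space_edge_law ne)
    also have "\<dots> = (\<integral>\<^sup>+ \<omega>. indicator {\<omega> \<in> space edge_space. (\<eta>, \<omega>) \<in> A} \<omega> \<partial>edge_law p_g p_b p_h \<eta>)"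
      by (rule nn_integral_cong) (auto simp: space_edge_law indicator_def)
    also have "\<dots> = emeasure (edge_law p_g p_b p_h \<eta>) {\<omega> \<in> space edge_space. (\<eta>, \<omega>) \<in> A}"
      by (rule nn_integral_indicator) (simp add: sets_edge_law)
    finally show "emeasure (edge_law p_g p_b p_h \<eta> \<bind>
        (\<lambda>\<omega>. return (layer_space \<Otimes>\<^sub>M edge_space) (\<eta>, \<omega>))) A
      = emeasure (edge_law p_g p_b p_h \<eta>) {\<omega> \<in> space edge_space. (\<eta>, \<omega>) \<in> A}" .
  qed
  finally show ?thesis .
qed

lemma prob_space_perc_law: "prob_space (perc_law \<delta> p_g p_b p_h)"
proof
  have s: "space (perc_law \<delta> p_g p_b p_h) = space (layer_space \<Otimes>\<^sub>M edge_space)"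
    by (rule sets_eq_imp_space_eq) (rule sets_perc_law)
  have "{\<omega> \<in> space edge_space. (\<eta>, \<omega>) \<in> space (layer_space \<Otimes>\<^sub>M edge_space)}
      = space (edge_law p_g p_b p_h \<eta>)" for \<eta>
    by (auto simp: space_edge_law space_pair_measure space_PiM PiE_def)
  then show "emeasure (perc_law \<delta> p_g p_b p_h) (space (perc_law \<delta> p_g p_b p_h)) = 1"
    using prob_space.emeasure_space_1[OF prob_space_edge_law]
      prob_space.emeasure_space_1[OF prob_space_layer_law]
    by (simp add: s emeasure_perc_law del: space_layer_law)
qed

lemma measurable_open_step [measurable]: "Measurable.pred edge_space (\<lambda>\<omega>. open_step \<omega> v w)"
proof -
  have "Measurable.pred edge_space (\<lambda>\<omega>. \<omega> (Up v w))" if "w \<in> up_nbrs v"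
    using that by (intro measurable_component_singleton) (unfold edges_def, blast)
  moreover have "Measurable.pred edge_space (\<lambda>\<omega>. \<omega> (Flat {v, w}))" if "w \<in> flat_nbrs v"
    using that by (intro measurable_component_singleton) (unfold edges_def, blast)
  ultimately show ?thesis
    unfolding open_step_def by (cases "w \<in> up_nbrs v"; cases "w \<in> flat_nbrs v") simp_all
qed

definition simple_open :: "(edge \<Rightarrow> bool) \<Rightarrow> site list \<Rightarrow> bool" where
  "simple_open \<omega> xs \<longleftrightarrow>
     xs \<noteq> [] \<and> hd xs = origin \<and> distinct xs \<and> (\<forall>i. Suc i < length xs \<longrightarrow> open_step \<omega> (xs ! i) (xs ! Suc i))"

lemma simple_open_prefix:
  assumes "simple_open \<omega> (xs @ ys)" "xs \<noteq> []"
  shows "simple_open \<omega> xs"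
  unfolding simple_open_def
proof (intro conjI allI impI)
  show "xs \<noteq> []" "hd xs = origin" "distinct xs" using assms by (auto simp: simple_open_def)
  show "open_step \<omega> (xs ! i) (xs ! Suc i)" if "Suc i < length xs" for i
    using assms(1) that unfolding simple_open_def
    by (metis Suc_lessD length_append nth_append trans_less_add1)
qed

lemma finite_nbrs: "finite (up_nbrs v \<union> flat_nbrs v)"
  by (cases v rule: up_nbrs.cases) simp

lemma percolates_iff: "percolates \<omega> \<longleftrightarrow> (\<forall>n. \<exists>xs. length xs = Suc n \<and> simple_open \<omega> xs)"
proof
  assume "percolates \<omega>"
  then obtain v where v: "v 0 = origin" "inj v" "\<And>n. open_step \<omega> (v n) (v (Suc n))"
    unfolding percolates_def by blast
  show "\<forall>n. \<exists>xs. length xs = Suc n \<and> simple_open \<omega> xs"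
  proof
    fix n
    have "inj_on v A" for A using v(2) by (rule inj_on_subset) simp
    then have "simple_open \<omega> (map v [0..<Suc n])"
      using v by (auto simp: simple_open_def hd_map distinct_map nth_append
          simp del: upt_Suc)
    then show "\<exists>xs. length xs = Suc n \<and> simple_open \<omega> xs" by (intro exI[of _ "map v [0..<Suc n]"]) simp
  qed
next
  assume long: "\<forall>n. \<exists>xs. length xs = Suc n \<and> simple_open \<omega> xs"
  define Q where "Q xs \<longleftrightarrow> simple_open \<omega> xs \<and> infinite {ys. simple_open \<omega> (xs @ ys)}" for xs
  have Q0: "Q [origin]"
  proof -
    have "infinite {ys. simple_open \<omega> ([origin] @ ys)}"
    proof
      assume "finite {ys. simple_open \<omega> ([origin] @ ys)}"
      then have f: "finite (length ` {ys. simple_open \<omega> ([origin] @ ys)})" by simp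
      have "n \<in> length ` {ys. simple_open \<omega> ([origin] @ ys)}" for n
      proof -
        obtain xs where xs: "length xs = Suc n" "simple_open \<omega> xs" using long by blast
        then have "xs = [origin] @ tl xs" by (cases xs) (auto simp: simple_open_def)
        with xs show ?thesis by (intro image_eqI[of _ _ "tl xs"]) auto
      qed
      then have "length ` {ys. simple_open \<omega> ([origin] @ ys)} = UNIV" by blast
      with f show False by simp
    qed
    then show ?thesis by (simp add: Q_def simple_open_def)
  qed
  have Qstep: "\<exists>w. Q (xs @ [w])" if "Q xs" for xs
  proof -
    have ne: "xs \<noteq> []" using that by (simp add: Q_def simple_open_def)
    let ?N = "up_nbrs (last xs) \<union> flat_nbrs (last xs)"
    have sub: "{ys. simple_open \<omega> (xs @ ys)}
      \<subseteq> {[]} \<union> (\<Union>w\<in>?N. (#) w ` {ys. simple_open \<omega> ((xs @ [w]) @ ys)})"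
    proof
      fix ys assume "ys \<in> {ys. simple_open \<omega> (xs @ ys)}"
      then have ys: "simple_open \<omega> (xs @ ys)" by simp
      show "ys \<in> {[]} \<union> (\<Union>w\<in>?N. (#) w ` {ys. simple_open \<omega> ((xs @ [w]) @ ys)})"
      proof (cases ys)
        case (Cons w zs)
        have "open_step \<omega> ((xs @ ys) ! (length xs - 1)) ((xs @ ys) ! Suc (length xs - 1))"
          using ys ne Cons unfolding simple_open_def
          by (metis Suc_pred' add.right_neutral add_Suc_right length_Cons length_append length_greater_0_conv less_add_same_cancel1 zero_less_Suc)
        moreover have "(xs @ ys) ! Suc (length xs - 1) = w"
          using ne Cons by simp
        ultimately have "open_step \<omega> (last xs) w"
          using ne by (simp add: nth_append last_conv_nth)
        then have "w \<in> ?N" by (auto simp: open_step_def)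
        then show ?thesis using ys Cons by auto
      qed simp
    qed
    have "\<exists>w\<in>?N. infinite {ys. simple_open \<omega> ((xs @ [w]) @ ys)}"
    proof (rule ccontr)
      assume "\<not> ?thesis"
      then have "finite ({[]} \<union> (\<Union>w\<in>?N. (#) w ` {ys. simple_open \<omega> ((xs @ [w]) @ ys)}))"
        using finite_nbrs[of "last xs"] by blast
      with sub that show False unfolding Q_def using finite_subset by blast
    qed
    then obtain w where w: "infinite {ys. simple_open \<omega> ((xs @ [w]) @ ys)}" by blast
    then obtain ys where "simple_open \<omega> ((xs @ [w]) @ ys)" using not_finite_existsD by blast
    then have "simple_open \<omega> (xs @ [w])" using simple_open_prefix by blast
    with w show ?thesis unfolding Q_def by blast
  qed
  obtain f where f: "f 0 = [origin]" "\<And>n. Q (f n)" "\<And>n. \<exists>w. f (Suc n) = f n @ [w]"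
  proof -
    have "\<exists>f. \<forall>n. (Q (f n) \<and> (n = 0 \<longrightarrow> f n = [origin])) \<and> (\<exists>w. f (Suc n) = f n @ [w])"
      by (rule dependent_nat_choice) (use Q0 Qstep in blast)+
    with that show thesis by blast
  qed
  define v where "v n = last (f n)" for n
  have fv: "f n = map v [0..<Suc n]" for n
  proof (induction n)
    case 0 then show ?case by (simp add: v_def f)
  next
    case (Suc n)
    obtain w where w: "f (Suc n) = f n @ [w]" using f(3) by blast
    then have "v (Suc n) = w" by (simp add: v_def)
    with w Suc show ?case by simp
  qed
  have so: "simple_open \<omega> (map v [0..<Suc n])" for n
    using f(2)[of n] by (simp only: Q_def fv)
  have "v 0 = origin" by (simp add: v_def f)
  moreover have "inj v"
  proof (rule injI)
    fix i j assume "v i = v j"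
    moreover have "inj_on v {0..<Suc (max i j)}"
      using so[of "max i j"] unfolding simple_open_def distinct_map set_upt by blast
    ultimately show "i = j" by (auto dest!: inj_onD)
  qed
  moreover have "open_step \<omega> (v n) (v (Suc n))" for n
  proof -
    have "open_step \<omega> (map v [0..<Suc (Suc n)] ! n) (map v [0..<Suc (Suc n)] ! Suc n)"
      using so[of "Suc n"] unfolding simple_open_def by (simp del: upt_Suc)
    then show ?thesis by (simp del: upt_Suc)
  qed
  ultimately show "percolates \<omega>" unfolding percolates_def by blast
qed

lemma measurable_percolates [measurable]: "Measurable.pred edge_space percolates"
proof -
  have [measurable]: "Measurable.pred edge_space (\<lambda>\<omega>. simple_open \<omega> xs)" for xs
    unfolding simple_open_def by measurable
  have *: "percolates = (\<lambda>\<omega>. \<forall>n. \<exists>xs. length xs = Suc n \<and> simple_open \<omega> xs)"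
    by (rule ext) (rule percolates_iff)
  show ?thesis unfolding * by measurable
qed

lemma percolates_in_sets:
  "{x \<in> space (perc_law \<delta> p_g p_b p_h). percolates (snd x)} \<in> sets (perc_law \<delta> p_g p_b p_h)"
  by measurable

lemma measurable_z2_cluster_size:
  "(\<lambda>\<omega>. emeasure (count_space UNIV) (z2_cluster \<omega>)) \<in> borel_measurable (z2_law p)"
proof -
  let ?M = "PiM z2_edges (\<lambda>_. count_space (UNIV :: bool set))"
  let ?R = "\<lambda>\<omega> x y. y \<in> z2_nbrs x \<and> \<omega> {x, y}"
  have [measurable]: "Measurable.pred ?M (\<lambda>\<omega>. ?R \<omega> x y)" for x y
  proof (cases "y \<in> z2_nbrs x")
    case True
    then have "Measurable.pred ?M (\<lambda>\<omega>. \<omega> {x, y})"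
      by (intro measurable_component_singleton) (unfold z2_edges_def, blast)
    then show ?thesis using True by simp
  qed simp
  have [measurable]: "Measurable.pred ?M (\<lambda>\<omega>. (?R \<omega> ^^ n) (0, 0) y)" for n y
  proof (induction n arbitrary: y)
    case 0 then show ?case by simp
  next
    case (Suc n)
    note Suc[measurable]
    have "Measurable.pred ?M (\<lambda>\<omega>. \<exists>z. (?R \<omega> ^^ n) (0, 0) z \<and> ?R \<omega> z y)" by measurable
    then show ?case by (simp add: relcompp_apply)
  qed
  have [measurable]: "Measurable.pred ?M (\<lambda>\<omega>. y \<in> z2_cluster \<omega>)" for y
    unfolding z2_cluster_def mem_Collect_eq rtranclp_power by measurable
  interpret sigma_finite_measure "count_space (UNIV :: (int \<times> int) set)"
    by (rule sigma_finite_measure_count_space_countable) simp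
  have ind: "(\<lambda>\<omega>. indicator (z2_cluster \<omega>) y :: ennreal) \<in> borel_measurable ?M" for y
    unfolding indicator_def by measurable
  have "(\<lambda>(y, \<omega>). indicator (z2_cluster \<omega>) y :: ennreal) \<in> borel_measurable (count_space UNIV \<Otimes>\<^sub>M ?M)"
    by (rule measurable_pair_measure_countable1) (simp_all add: ind)
  from measurable_pair_swap[OF this]
  have "(\<lambda>(\<omega>, y). indicator (z2_cluster \<omega>) y :: ennreal) \<in> borel_measurable (?M \<Otimes>\<^sub>M count_space UNIV)"
    by simp
  then have "(\<lambda>\<omega>. \<integral>\<^sup>+ y. indicator (z2_cluster \<omega>) y \<partial>count_space UNIV) \<in> borel_measurable ?M"
    by (rule borel_measurable_nn_integral)
  then show ?thesis
    by (simp add: measurable_cong_sets[OF sets_z2_law refl])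
qed

end

theory Submission
  imports Defs "HOL-Real_Asymp.Real_Asymp"
begin

text \<open>
  Fix the layer types. A site of layer \<open>n\<close> entered from below is joined on average to
  \<open>\<chi>\<close> sites of its layer, each with four upward edges, so a bad layer multiplies the
  expected number of entered sites by at most \<open>4 \<chi> p\<^sub>b < \<delta>\<^sup>2 / 4\<close>, and a run of \<open>r\<close> bad
  layers by its \<open>r\<close>-th power. Such a run starts, with overwhelming probability, below a
  height \<open>N\<close> of order \<open>r (3 / (2 \<delta>))\<^sup>r\<close>. The good layers below are controlled
  even for \<open>p\<^sub>g = 1\<close>: since \<open>\<chi> < \<infinity>\<close> the connectivity of the planar model decays
  exponentially (Hammersley, Simon), so the exponentially weighted number of entered sites
  grows at most exponentially with the height and the entered sites at height at most \<open>N\<close>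
  lie in a square of side \<open>O(N)\<close>, up to a negligible remainder. Hence the expected number of
  sites entered after the run is at most of order \<open>N\<^sup>2 (\<delta>\<^sup>2 / 4)\<^sup>r\<close>, of order \<open>r\<^sup>2 (9 / 16)\<^sup>r\<close>,
  which tends to \<open>0\<close>. Percolation inside a single layer has probability \<open>0\<close>,
  again because \<open>\<chi> < \<infinity>\<close>.
\<close>

section \<open>Independence in product measures\<close>

text \<open>Quantifying over all functions, not just points of a product space, keeps the notion
  free of any measure; measurability is demanded separately wherever it is used.\<close>

definition determined :: "'i set \<Rightarrow> (('i \<Rightarrow> 'a) \<Rightarrow> bool) \<Rightarrow> bool" where
  "determined J P \<longleftrightarrow> (\<forall>\<omega> \<omega>'. (\<forall>i\<in>J. \<omega> i = \<omega>' i) \<longrightarrow> P \<omega> = P \<omega>')"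

lemma determined_mono: "determined J P \<Longrightarrow> J \<subseteq> K \<Longrightarrow> determined K P"
  unfolding determined_def by blast

lemma determined_conj: "determined J P \<Longrightarrow> determined J Q \<Longrightarrow> determined J (\<lambda>\<omega>. P \<omega> \<and> Q \<omega>)"
  unfolding determined_def by blast

text \<open>Freezing the coordinates outside \<open>J\<close> at a fixed point \<open>z\<close>
  turns \<open>P\<close> into a measurable event of the restriction to \<open>J \<inter> I\<close>.
  Restrictions to disjoint index sets are independent, so the probabilities multiply.\<close>

lemma emeasure_PiM_conj:
  fixes M :: "'i \<Rightarrow> 'a measure"
  assumes M: "\<And>i. prob_space (M i)"
    and P: "Measurable.pred (PiM I M) P" "determined J P"
    and Q: "Measurable.pred (PiM I M) Q" "determined K Q"
    and JK: "J \<inter> K \<inter> I = {}"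
  shows "emeasure (PiM I M) {\<omega> \<in> space (PiM I M). P \<omega> \<and> Q \<omega>}
    = emeasure (PiM I M) {\<omega> \<in> space (PiM I M). P \<omega>} * emeasure (PiM I M) {\<omega> \<in> space (PiM I M). Q \<omega>}"
proof -
  interpret prob_space "PiM I M" by (rule prob_space_PiM) (rule M)
  have restr: "\<exists>A. A \<in> sets (PiM (J \<inter> I) M) \<and>
      {\<omega> \<in> space (PiM I M). P \<omega>} = (\<lambda>\<omega>. restrict \<omega> (J \<inter> I)) -` A \<inter> space (PiM I M)"
    if P: "Measurable.pred (PiM I M) P" "determined J P" for P J
  proof -
    obtain z where z: "z \<in> space (PiM I M)"
      using prob_space.not_empty[OF prob_space_PiM[of I M]] M by blast
    have [measurable]: "(\<lambda>\<omega>. merge (J \<inter> I) (I - J) (\<omega>, z)) \<in> PiM (J \<inter> I) M \<rightarrow>\<^sub>M PiM I M"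
    proof (rule measurable_PiM_single')
      show "(\<lambda>\<omega>. merge (J \<inter> I) (I - J) (\<omega>, z)) \<in> space (Pi\<^sub>M (J \<inter> I) M) \<rightarrow> (\<Pi>\<^sub>E i\<in>I. space (M i))"
        using z by (auto simp: merge_def space_PiM PiE_iff extensional_def)
      show "(\<lambda>\<omega>. merge (J \<inter> I) (I - J) (\<omega>, z) i) \<in> Pi\<^sub>M (J \<inter> I) M \<rightarrow>\<^sub>M M i" if "i \<in> I" for i
        using that z by (cases "i \<in> J") (auto simp: merge_def space_PiM PiE_iff)
    qed
    note P(1)[measurable]
    let ?A = "{\<omega> \<in> space (PiM (J \<inter> I) M). P (merge (J \<inter> I) (I - J) (\<omega>, z))}"
    have A: "?A \<in> sets (PiM (J \<inter> I) M)" by measurable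
    have eq: "P (merge (J \<inter> I) (I - J) (restrict \<omega> (J \<inter> I), z)) = P \<omega>" if "\<omega> \<in> space (PiM I M)" for \<omega>
    proof -
      have "(merge (J \<inter> I) (I - J) (restrict \<omega> (J \<inter> I), z)) i = \<omega> i" if "i \<in> J" for i
        using that \<open>\<omega> \<in> space _\<close> by (auto simp: merge_def space_PiM PiE_iff extensional_def)
      then show ?thesis using P(2) unfolding determined_def by blast
    qed
    have "restrict \<omega> (J \<inter> I) \<in> space (PiM (J \<inter> I) M)" if "\<omega> \<in> space (PiM I M)" for \<omega>
      using that by (auto simp: space_PiM)
    with eq have "{\<omega> \<in> space (PiM I M). P \<omega>} = (\<lambda>\<omega>. restrict \<omega> (J \<inter> I)) -` ?A \<inter> space (PiM I M)"
      by auto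
    with A show ?thesis by blast
  qed
  obtain A where A: "A \<in> sets (PiM (J \<inter> I) M)"
      "{\<omega> \<in> space (PiM I M). P \<omega>} = (\<lambda>\<omega>. restrict \<omega> (J \<inter> I)) -` A \<inter> space (PiM I M)"
    using restr[OF P] by blast
  obtain B where B: "B \<in> sets (PiM (K \<inter> I) M)"
      "{\<omega> \<in> space (PiM I M). Q \<omega>} = (\<lambda>\<omega>. restrict \<omega> (K \<inter> I)) -` B \<inter> space (PiM I M)"
    using restr[OF Q] by blast
  \<comment> \<open>The joint law of the coordinates is the product measure itself and its factors
    are their marginals, which is independence.\<close>
  have "indep_vars M (\<lambda>i \<omega>. \<omega> i) I"
  proof (cases "I = {}")
    case True then show ?thesis unfolding indep_vars_def indep_sets_def by auto
  next
    case False
    then show ?thesis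
    proof (subst indep_vars_iff_distr_eq_PiM')
      have "distr (PiM I M) (PiM I M) (\<lambda>x. restrict x I) = PiM I M"
        by (rule trans[OF distr_cong[OF refl refl] distr_id]) (auto simp: space_PiM)
      moreover have "PiM I (\<lambda>i. distr (PiM I M) (M i) (\<lambda>\<omega>. \<omega> i)) = PiM I M"
        by (rule PiM_cong[OF refl]) (rule distr_PiM_component, use M in auto)
      ultimately show "distr (PiM I M) (PiM I M) (\<lambda>x. restrict x I)
          = PiM I (\<lambda>i. distr (PiM I M) (M i) (\<lambda>\<omega>. \<omega> i))" by simp
    qed auto
  qed
  then have "indep_var (PiM (J \<inter> I) M) (\<lambda>\<omega>. restrict \<omega> (J \<inter> I)) (PiM (K \<inter> I) M) (\<lambda>\<omega>. restrict \<omega> (K \<inter> I))"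
    by (rule indep_var_restrict) (use JK in auto)
  from indep_varD[OF this A(1) B(1)]
  have "prob {\<omega> \<in> space (PiM I M). P \<omega> \<and> Q \<omega>}
    = prob {\<omega> \<in> space (PiM I M). P \<omega>} * prob {\<omega> \<in> space (PiM I M). Q \<omega>}"
    unfolding A(2) B(2)
    by (rule back_subst[where P="\<lambda>S. prob S = _"]) (use A(2) B(2) in auto)
  then show ?thesis by (simp add: emeasure_eq_measure ennreal_mult)
qed

text \<open>The union bound, with the countable sum written as an integral against counting measure
  so that sums over sites can later be interchanged by Tonelli.\<close>

lemma emeasure_le_nn_integral_union:
  fixes P :: "'i :: countable \<Rightarrow> 'a \<Rightarrow> bool"
  assumes [measurable]: "Measurable.pred M Q" "\<And>i. Measurable.pred M (P i)"
    and sub: "\<And>\<omega>. \<omega> \<in> space M \<Longrightarrow> Q \<omega> \<Longrightarrow> \<exists>i. P i \<omega>"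
  shows "emeasure M {\<omega> \<in> space M. Q \<omega>} \<le> (\<integral>\<^sup>+ i. emeasure M {\<omega> \<in> space M. P i \<omega>} \<partial>count_space UNIV)"
proof -
  have "emeasure M {\<omega> \<in> space M. Q \<omega>} = (\<integral>\<^sup>+ \<omega>. indicator {\<omega> \<in> space M. Q \<omega>} \<omega> \<partial>M)"
    by simp
  also have "\<dots> \<le> (\<integral>\<^sup>+ \<omega>. (\<integral>\<^sup>+ i. indicator {\<omega> \<in> space M. P i \<omega>} \<omega> \<partial>count_space UNIV) \<partial>M)"
  proof (rule nn_integral_mono)
    fix \<omega> assume w: "\<omega> \<in> space M"
    show "indicator {\<omega> \<in> space M. Q \<omega>} \<omega> \<le>
        (\<integral>\<^sup>+ i. indicator {\<omega> \<in> space M. P i \<omega>} \<omega> \<partial>count_space UNIV)"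
    proof (cases "Q \<omega>")
      case True
      then obtain i where "P i \<omega>" using sub w by blast
      then have "indicator {\<omega> \<in> space M. Q \<omega>} \<omega> \<le> (indicator {\<omega> \<in> space M. P i \<omega>} \<omega> :: ennreal)"
        using w by (simp add: indicator_def)
      also have "\<dots> \<le> (\<integral>\<^sup>+ i. indicator {\<omega> \<in> space M. P i \<omega>} \<omega> \<partial>count_space UNIV)"
        by (rule nn_integral_ge_point) simp
      finally show ?thesis .
    qed simp
  qed
  also have "\<dots> = (\<integral>\<^sup>+ i. (\<integral>\<^sup>+ \<omega>. indicator {\<omega> \<in> space M. P i \<omega>} \<omega> \<partial>M) \<partial>count_space UNIV)"
    by (rule nn_integral_count_space_nn_integral) auto
  also have "\<dots> = (\<integral>\<^sup>+ i. emeasure M {\<omega> \<in> space M. P i \<omega>} \<partial>count_space UNIV)"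
    by simp
  finally show ?thesis .
qed

section \<open>Connectivity on the square lattice\<close>

text \<open>Reflexive at every site, even outside \<open>A\<close>.\<close>

definition zconn :: "(int \<times> int) set \<Rightarrow> ((int \<times> int) set \<Rightarrow> bool) \<Rightarrow> int \<times> int \<Rightarrow> int \<times> int \<Rightarrow> bool" where
  "zconn A \<omega> = (\<lambda>x y. y \<in> z2_nbrs x \<and> \<omega> {x, y} \<and> x \<in> A \<and> y \<in> A)\<^sup>*\<^sup>*"

text \<open>The sup norm: balls are squares with \<open>(2 * k + 1)^2\<close> sites, and a
  horizontal step or a diagonal upward step raises the norm by at most one.\<close>

definition znorm :: "int \<times> int \<Rightarrow> nat" where
  "znorm x = nat (max \<bar>fst x\<bar> \<bar>snd x\<bar>)"

text \<open>The two-point function of planar percolation, valued in \<open>ennreal\<close> so that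
  it can be summed without convergence conditions.\<close>

definition tau :: "real \<Rightarrow> int \<times> int \<Rightarrow> int \<times> int \<Rightarrow> ennreal" where
  "tau p x y = emeasure (z2_law p) {\<omega> \<in> space (z2_law p). zconn UNIV \<omega> x y}"

lemma z2_nbrs_add: "y \<in> z2_nbrs x \<Longrightarrow> a + y \<in> z2_nbrs (a + x)"
  by (cases x; cases y; cases a) auto

lemma finite_z2_nbrs: "finite (z2_nbrs x)"
  by (cases x) auto

lemma card_z2_nbrs: "card (z2_nbrs x) \<le> 4"
proof (cases x)
  case (Pair a b)
  then show ?thesis
    using card_length[of "[(a + 1, b), (a - 1, b), (a, b + 1), (a, b - 1)]"] by simp
qed

lemma z2_edgesI: "y \<in> z2_nbrs x \<Longrightarrow> {x, y} \<in> z2_edges"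
  unfolding z2_edges_def by blast

lemma znorm_triangle: "znorm (x + y) \<le> znorm x + znorm y"
proof -
  have "max \<bar>fst (x + y)\<bar> \<bar>snd (x + y)\<bar> \<le> max \<bar>fst x\<bar> \<bar>snd x\<bar> + max \<bar>fst y\<bar> \<bar>snd y\<bar>"
    by (rule max.boundedI; simp only: fst_add snd_add; rule order_trans[OF abs_triangle_ineq add_mono]; simp)
  then show ?thesis unfolding znorm_def by (subst nat_add_distrib[symmetric]) (auto intro: nat_mono)
qed

lemma znorm_nbr: "y \<in> z2_nbrs x \<Longrightarrow> znorm y \<le> znorm x + 1"
  by (cases x; cases y) (auto simp: znorm_def)

lemma znorm_le_eq: "{x. znorm x \<le> k} = {- int k..int k} \<times> {- int k..int k}"
  by (auto simp: znorm_def)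

lemma finite_znorm_le: "finite {x. znorm x \<le> k}"
  by (simp add: znorm_le_eq)

lemma card_znorm_le: "card {x. znorm x \<le> k} = (2 * k + 1)\<^sup>2"
  by (simp add: znorm_le_eq card_cartesian_product power2_eq_square nat_add_distrib nat_mult_distrib)

lemma zconn_mono: "zconn A \<omega> x y \<Longrightarrow> A \<subseteq> B \<Longrightarrow> zconn B \<omega> x y"
  unfolding zconn_def by (erule rtranclp_mono[THEN predicate2D, rotated]) auto

lemma zconn_cong:
  assumes "zconn A \<omega> x y" "\<And>e. e \<in> z2_edges \<Longrightarrow> e \<subseteq> A \<Longrightarrow> \<omega> e = \<omega>' e"
  shows "zconn A \<omega>' x y"
  using assms(1) unfolding zconn_def
proof (rule rtranclp_mono[THEN predicate2D, rotated], safe)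
  fix a b c d assume "(c, d) \<in> z2_nbrs (a, b)" "\<omega> {(a, b), (c, d)}" "(a, b) \<in> A" "(c, d) \<in> A"
  then show "\<omega>' {(a, b), (c, d)}"
    using assms(2)[of "{(a, b), (c, d)}"] z2_edgesI by blast
qed

lemma determined_zconn: "determined {e \<in> z2_edges. e \<subseteq> A} (\<lambda>\<omega>. zconn A \<omega> x y)"
  unfolding determined_def
proof (intro allI impI iffI)
  fix \<omega> \<omega>' :: "(int \<times> int) set \<Rightarrow> bool"
  assume eq: "\<forall>e\<in>{e \<in> z2_edges. e \<subseteq> A}. \<omega> e = \<omega>' e"
  show "zconn A \<omega>' x y" if "zconn A \<omega> x y"
    using that by (rule zconn_cong) (use eq in blast)
  show "zconn A \<omega> x y" if "zconn A \<omega>' x y"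
    using that by (rule zconn_cong) (use eq in blast)
qed

text \<open>The closure is a countable union over path lengths, and a path of length
  \<open>n + 1\<close> is a countable union over its last but one state.\<close>

lemma measurable_rtranclp:
  fixes R :: "'a \<Rightarrow> 'b :: countable \<Rightarrow> 'b \<Rightarrow> bool"
  assumes [measurable]: "\<And>x y. Measurable.pred M (\<lambda>\<omega>. R \<omega> x y)"
  shows "Measurable.pred M (\<lambda>\<omega>. (R \<omega>)\<^sup>*\<^sup>* x y)"
proof -
  have [measurable]: "Measurable.pred M (\<lambda>\<omega>. (R \<omega> ^^ n) x y)" for n y
  proof (induction n arbitrary: y)
    case (Suc n)
    note Suc[measurable]
    have "Measurable.pred M (\<lambda>\<omega>. \<exists>z. (R \<omega> ^^ n) x z \<and> R \<omega> z y)" by measurable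
    then show ?case by (simp add: relcompp_apply)
  qed simp
  show ?thesis unfolding rtranclp_power by measurable
qed

lemma measurable_zconn [measurable]:
  "Measurable.pred (PiM z2_edges (\<lambda>_. count_space UNIV)) (\<lambda>\<omega>. zconn A \<omega> x y)"
proof -
  let ?M = "PiM z2_edges (\<lambda>_. count_space (UNIV :: bool set))"
  let ?R = "\<lambda>\<omega> x y. y \<in> z2_nbrs x \<and> \<omega> {x, y} \<and> x \<in> A \<and> y \<in> A"
  have "Measurable.pred ?M (\<lambda>\<omega>. ?R \<omega> x y)" for x y
  proof (cases "y \<in> z2_nbrs x")
    case True
    then have "Measurable.pred ?M (\<lambda>\<omega>. \<omega> {x, y})"
      by (intro measurable_component_singleton z2_edgesI)
    then show ?thesis by simp
  qed simp
  then show ?thesis unfolding zconn_def by (rule measurable_rtranclp)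
qed

lemma zconn_shift: "zconn UNIV (\<lambda>e. \<omega> ((+) a ` e)) x y \<longleftrightarrow> zconn UNIV \<omega> (a + x) (a + y)"
proof -
  have *: "zconn UNIV \<omega> (a + x) (a + y)" if "zconn UNIV (\<lambda>e. \<omega> ((+) a ` e)) x y" for \<omega> a x y
    using that unfolding zconn_def
  proof (induction rule: rtranclp_induct)
    case (step y z)
    show ?case
      by (rule rtranclp.rtrancl_into_rtrancl[OF step.IH]) (use step.hyps(2) z2_nbrs_add in simp)
  qed simp
  show ?thesis
  proof
    assume "zconn UNIV \<omega> (a + x) (a + y)"
    then have "zconn UNIV (\<lambda>e. \<omega> ((+) a ` (+) (- a) ` e)) (a + x) (a + y)"
      by (simp add: image_image)
    from *[of "\<lambda>e. \<omega> ((+) a ` e)" "- a", OF this] show "zconn UNIV (\<lambda>e. \<omega> ((+) a ` e)) x y"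
      by simp
  qed (rule *)
qed

text \<open>Relabelling coordinates along an injection preserves product laws. This serves twice:
  for translations of the plane, and for the copy of the plane formed by the horizontal edges of a
  layer.\<close>

lemma emeasure_PiM_zconn:
  assumes M: "\<And>i. prob_space (M i)"
    and f: "inj_on f z2_edges" "f \<in> z2_edges \<rightarrow> K"
    and Mf: "\<And>e. e \<in> z2_edges \<Longrightarrow> M (f e) = measure_pmf (bernoulli_pmf p)"
  shows "emeasure (PiM K M) {\<omega> \<in> space (PiM K M). zconn UNIV (\<lambda>e. \<omega> (f e)) x y} = tau p x y"
    and "Measurable.pred (PiM K M) (\<lambda>\<omega>. zconn UNIV (\<lambda>e. \<omega> (f e)) x y)"
proof -
  let ?t = "\<lambda>\<omega>. \<lambda>e\<in>z2_edges. \<omega> (f e)"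
  have law: "(\<Pi>\<^sub>M i\<in>z2_edges. M (f i)) = z2_law p"
    unfolding z2_law_def by (rule PiM_cong) (simp_all add: Mf)
  have distr: "distr (PiM K M) (z2_law p) ?t = z2_law p"
    using distr_PiM_reindex[where M = M, OF M f] by (simp add: law)
  have t [measurable]: "?t \<in> PiM K M \<rightarrow>\<^sub>M z2_law p"
  proof -
    have "?t \<in> PiM K M \<rightarrow>\<^sub>M (\<Pi>\<^sub>M i\<in>z2_edges. M (f i))"
      by (intro measurable_restrict measurable_component_singleton) (use f(2) in blast)
    then show ?thesis by (simp only: law)
  qed
  \<comment> \<open>\<open>?t\<close> must truncate to \<open>z2_edges\<close> to land in the
    product space; connectivity reads only such edges and does not notice.\<close>
  have eq: "zconn UNIV (?t \<omega>) x y = zconn UNIV (\<lambda>e. \<omega> (f e)) x y" for \<omega>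
    using determined_zconn[of UNIV x y] unfolding determined_def by auto
  have "Measurable.pred (PiM K M) (\<lambda>\<omega>. zconn UNIV (?t \<omega>) x y)"
    by (rule measurable_compose[OF t]) measurable
  then show m: "Measurable.pred (PiM K M) (\<lambda>\<omega>. zconn UNIV (\<lambda>e. \<omega> (f e)) x y)"
    by (simp add: eq)
  have "tau p x y = emeasure (distr (PiM K M) (z2_law p) ?t) {\<omega> \<in> space (z2_law p). zconn UNIV \<omega> x y}"
    by (simp add: tau_def distr)
  also have "\<dots> = emeasure (PiM K M) (?t -` {\<omega> \<in> space (z2_law p). zconn UNIV \<omega> x y} \<inter> space (PiM K M))"
    by (rule emeasure_distr) measurable
  also have "?t -` {\<omega> \<in> space (z2_law p). zconn UNIV \<omega> x y} \<inter> space (PiM K M)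
      = {\<omega> \<in> space (PiM K M). zconn UNIV (\<lambda>e. \<omega> (f e)) x y}"
    using measurable_space[OF t] by (auto simp: eq)
  finally show "emeasure (PiM K M) {\<omega> \<in> space (PiM K M). zconn UNIV (\<lambda>e. \<omega> (f e)) x y} = tau p x y" ..
qed

text \<open>A translation permutes \<open>z2_edges\<close>, and all of these edges have the same
  marginal.\<close>

lemma tau_shift: "tau p (a + x) (a + y) = tau p x y"
proof -
  have "emeasure (z2_law p) {\<omega> \<in> space (z2_law p). zconn UNIV (\<lambda>e. \<omega> ((+) a ` e)) x y} = tau p x y"
    unfolding z2_law_def
  proof (rule emeasure_PiM_zconn)
    show "inj_on ((`) ((+) a)) z2_edges"
      by (rule inj_on_subset[of _ UNIV]) (simp_all add: inj_on_def inj_image_eq_iff)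
    show "(`) ((+) a) \<in> z2_edges \<rightarrow> z2_edges"
    proof
      fix e assume "e \<in> z2_edges"
      then obtain x y where "e = {x, y}" "y \<in> z2_nbrs x" unfolding z2_edges_def by blast
      then show "(+) a ` e \<in> z2_edges" using z2_edgesI[OF z2_nbrs_add] by simp
    qed
  qed (simp_all add: prob_space_measure_pmf)
  then show ?thesis by (simp add: zconn_shift tau_def)
qed

lemma tau_diff: "tau p x y = tau p 0 (y - x)"
  using tau_shift[of p x 0 "y - x"] by simp

lemma tau_le_1: "tau p x y \<le> 1"
  unfolding tau_def using prob_space.emeasure_le_1[OF prob_space_z2_law] .

text \<open>Tonelli: the expected size of the cluster is the sum over sites of the probability of
  belonging to it.\<close>

lemma chi_eq: "chi p = (\<integral>\<^sup>+ x. tau p 0 x \<partial>count_space UNIV)"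
proof -
  have cluster_in: "z2_cluster \<omega> = {x. zconn UNIV \<omega> 0 x}" for \<omega>
    by (simp add: z2_cluster_def zconn_def zero_prod_def)
  have "chi p = (\<integral>\<^sup>+ \<omega>. \<integral>\<^sup>+ x. indicator {\<omega> \<in> space (z2_law p). zconn UNIV \<omega> 0 x} \<omega> \<partial>count_space UNIV \<partial>z2_law p)"
    unfolding chi_def
  proof (rule nn_integral_cong)
    fix \<omega> assume "\<omega> \<in> space (z2_law p)"
    then have "(\<integral>\<^sup>+ x. indicator {\<omega> \<in> space (z2_law p). zconn UNIV \<omega> 0 x} \<omega> \<partial>count_space UNIV)
      = (\<integral>\<^sup>+ x. indicator (z2_cluster \<omega>) x \<partial>count_space UNIV)"
      by (intro nn_integral_cong) (auto simp: cluster_in indicator_def)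
    also have "\<dots> = emeasure (count_space UNIV) (z2_cluster \<omega>)" by simp
    finally show "emeasure (count_space UNIV) (z2_cluster \<omega>) =
      (\<integral>\<^sup>+ x. indicator {\<omega> \<in> space (z2_law p). zconn UNIV \<omega> 0 x} \<omega> \<partial>count_space UNIV)" ..
  qed
  also have "\<dots> = (\<integral>\<^sup>+ x. \<integral>\<^sup>+ \<omega>. indicator {\<omega> \<in> space (z2_law p). zconn UNIV \<omega> 0 x} \<omega> \<partial>z2_law p \<partial>count_space UNIV)"
    by (rule nn_integral_count_space_nn_integral) auto
  also have "\<dots> = (\<integral>\<^sup>+ x. tau p 0 x \<partial>count_space UNIV)"
    unfolding tau_def by (intro nn_integral_cong nn_integral_indicator) measurable
  finally show ?thesis .
qed

section \<open>Exponential decay of connectivity\<close>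

text \<open>Paths are confined to \<open>B\<close> so that this set can be explored by inspecting
  only edges inside \<open>B\<close> that touch it.\<close>

definition cluster_in :: "(int \<times> int) set \<Rightarrow> ((int \<times> int) set \<Rightarrow> bool) \<Rightarrow> (int \<times> int) set" where
  "cluster_in B \<omega> = {x. zconn B \<omega> 0 x}"

lemma cluster_in_step: "x \<in> cluster_in B \<omega> \<Longrightarrow> y \<in> z2_nbrs x \<Longrightarrow> \<omega> {x, y} \<Longrightarrow> x \<in> B \<Longrightarrow> y \<in> B \<Longrightarrow> y \<in> cluster_in B \<omega>"
  unfolding cluster_in_def zconn_def by (simp add: rtranclp.rtrancl_into_rtrancl)

lemma cluster_in_subset: "0 \<in> B \<Longrightarrow> cluster_in B \<omega> \<subseteq> B"
  unfolding cluster_in_def zconn_def by (auto elim: rtranclp.cases)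

text \<open>An exploration from \<open>0\<close> within \<open>B\<close> only ever queries edges
  that touch the explored set, so two configurations agreeing on those edges yield the same
  set.\<close>

lemma cluster_in_cong:
  assumes B: "0 \<in> B" and eq: "\<And>e. e \<subseteq> B \<Longrightarrow> e \<inter> cluster_in B \<omega> \<noteq> {} \<Longrightarrow> e \<in> z2_edges \<Longrightarrow> \<omega> e = \<omega>' e"
  shows "cluster_in B \<omega>' = cluster_in B \<omega>"
proof (intro equalityI subsetI)
  fix x assume "x \<in> cluster_in B \<omega>'"
  then have "zconn B \<omega>' 0 x" by (simp add: cluster_in_def)
  then show "x \<in> cluster_in B \<omega>" unfolding zconn_def
  proof (induction rule: rtranclp_induct)
    case base then show ?case by (simp add: cluster_in_def zconn_def)
  next
    case (step y z)
    then have "\<omega> {y, z}" using eq[of "{y, z}"] z2_edgesI by auto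
    with step show ?case by (auto intro: cluster_in_step)
  qed
next
  fix x assume "x \<in> cluster_in B \<omega>"
  then have "zconn B \<omega> 0 x" by (simp add: cluster_in_def)
  \<comment> \<open>Both memberships are carried through the induction: the hypothesis on edges
    refers to the cluster of \<omega>, while the path is being rebuilt in \<omega>'.\<close>
  then have "x \<in> cluster_in B \<omega> \<and> x \<in> cluster_in B \<omega>'" unfolding zconn_def
  proof (induction rule: rtranclp_induct)
    case base then show ?case by (simp add: cluster_in_def zconn_def)
  next
    case (step y z)
    then have "\<omega>' {y, z}" using eq[of "{y, z}"] z2_edgesI by auto
    with step show ?case by (auto intro: cluster_in_step)
  qed
  then show "x \<in> cluster_in B \<omega>'" ..
qed

text \<open>These edges are disjoint from the edges inside the complement of \<open>S\<close>. That
  disjointness supplies the independence in the Simon-type inequality below.\<close>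

lemma determined_cluster_in:
  assumes B: "0 \<in> B"
  shows "determined {e \<in> z2_edges. e \<inter> S \<noteq> {}} (\<lambda>\<omega>. cluster_in B \<omega> = S)"
  unfolding determined_def
proof (intro allI impI iffI)
  fix \<omega> \<omega>' :: "(int \<times> int) set \<Rightarrow> bool"
  assume eq: "\<forall>e\<in>{e \<in> z2_edges. e \<inter> S \<noteq> {}}. \<omega> e = \<omega>' e"
  show "cluster_in B \<omega>' = S" if "cluster_in B \<omega> = S"
    using cluster_in_cong[OF B, of \<omega> \<omega>'] eq that by auto
  show "cluster_in B \<omega> = S" if "cluster_in B \<omega>' = S"
    using cluster_in_cong[OF B, of \<omega>' \<omega>] eq that by auto
qed

lemma measurable_cluster_in [measurable]:
  "Measurable.pred (PiM z2_edges (\<lambda>_. count_space UNIV)) (\<lambda>\<omega>. cluster_in B \<omega> = S)"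
  unfolding cluster_in_def set_eq_iff mem_Collect_eq by measurable

text \<open>Cut a path from \<open>0\<close> at its last visit to the cluster of \<open>0\<close> within \<open>B\<close>.\<close>

lemma zconn_last_exit:
  assumes B: "0 \<in> B" and z: "z \<notin> B" and "zconn UNIV \<omega> 0 z"
  shows "\<exists>x\<in>cluster_in B \<omega>. \<exists>y\<in>z2_nbrs x - B. zconn (- cluster_in B \<omega>) \<omega> y z"
proof -
  have "zconn UNIV \<omega> 0 z" by fact
  then have "(z \<in> cluster_in B \<omega>) \<or> (\<exists>x\<in>cluster_in B \<omega>. \<exists>y\<in>z2_nbrs x - B. zconn (- cluster_in B \<omega>) \<omega> y z)"
    unfolding zconn_def[of UNIV]
  proof (induction rule: rtranclp_induct)
    case base then show ?case by (simp add: cluster_in_def zconn_def)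
  next
    case (step u v)
    show ?case
    proof (cases "v \<in> cluster_in B \<omega>")
      case v: False
      show ?thesis
      proof (cases "u \<in> cluster_in B \<omega>")
        case True
        then have "v \<notin> B" using v step.hyps(2) cluster_in_step cluster_in_subset[OF B] by blast
        moreover have "zconn (- cluster_in B \<omega>) \<omega> v v" by (simp add: zconn_def)
        ultimately show ?thesis using True step.hyps(2) by blast
      next
        case False
        then obtain x y where "x \<in> cluster_in B \<omega>" "y \<in> z2_nbrs x - B" and y: "zconn (- cluster_in B \<omega>) \<omega> y u"
          using step.IH by blast
        moreover have "zconn (- cluster_in B \<omega>) \<omega> y v"
          using y v False step.hyps(2) unfolding zconn_def
          by (auto intro: rtranclp.rtrancl_into_rtrancl)
        ultimately show ?thesis by blast
      qed
    qed simp
  qed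
  then show ?thesis using z cluster_in_subset[OF B] by blast
qed

text \<open>A Simon-type inequality, by conditioning on the value \<open>S\<close> of the cluster
  within \<open>B\<close>. After its last exit from \<open>S\<close> the path to \<open>z\<close>
  stays in the complement of \<open>S\<close>, hence uses edges independent of the event that the
  cluster is \<open>S\<close>. Summing over all \<open>S\<close> containing \<open>x\<close> leaves
  \<open>tau p 0 x\<close>.\<close>

lemma tau_le_exit:
  assumes B: "finite B" "0 \<in> B" and z: "z \<notin> B"
  shows "tau p 0 z \<le> (\<Sum>x\<in>B. \<Sum>y\<in>z2_nbrs x - B. tau p 0 x * tau p y z)"
proof -
  let ?M = "z2_law p"
  let ?E = "\<lambda>x S. {\<omega> \<in> space ?M. cluster_in B \<omega> = S}"
  let ?G = "\<lambda>x y. {\<omega> \<in> space ?M. \<exists>S\<in>{S. S \<subseteq> B \<and> x \<in> S}. cluster_in B \<omega> = S \<and> zconn (- S) \<omega> y z}"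
  let ?I = "SIGMA x:B. z2_nbrs x - B"
  have fin: "finite {S. S \<subseteq> B \<and> x \<in> S}" for x using B by simp
  have finI: "finite ?I" using B finite_z2_nbrs by auto
  have cS: "countable {S. S \<subseteq> B \<and> x \<in> S}" for x using fin by (rule countable_finite)
  have G[measurable]: "?G x y \<in> sets ?M" for x y
    using cS by measurable
  have Gle: "emeasure ?M (?G x y) \<le> tau p 0 x * tau p y z" for x y
  proof -
    have "?G x y = (\<Union>S\<in>{S. S \<subseteq> B \<and> x \<in> S}. {\<omega> \<in> space ?M. cluster_in B \<omega> = S \<and> zconn (- S) \<omega> y z})"
      by blast
    then have "emeasure ?M (?G x y)
        = (\<Sum>S\<in>{S. S \<subseteq> B \<and> x \<in> S}. emeasure ?M {\<omega> \<in> space ?M. cluster_in B \<omega> = S \<and> zconn (- S) \<omega> y z})"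
      by (simp only:) (rule sum_emeasure[symmetric], use fin in \<open>auto simp: disjoint_family_on_def\<close>)
    also have "\<dots> \<le> (\<Sum>S\<in>{S. S \<subseteq> B \<and> x \<in> S}. emeasure ?M {\<omega> \<in> space ?M. cluster_in B \<omega> = S} * tau p y z)"
    proof (rule sum_mono)
      fix S
      have "emeasure ?M {\<omega> \<in> space ?M. cluster_in B \<omega> = S \<and> zconn (- S) \<omega> y z}
        = emeasure ?M {\<omega> \<in> space ?M. cluster_in B \<omega> = S} * emeasure ?M {\<omega> \<in> space ?M. zconn (- S) \<omega> y z}"
        unfolding z2_law_def
      proof (rule emeasure_PiM_conj[OF _ _ determined_cluster_in[OF B(2)] _ determined_zconn])
        show "Measurable.pred (\<Pi>\<^sub>M e\<in>z2_edges. measure_pmf (bernoulli_pmf p)) (\<lambda>\<omega>. cluster_in B \<omega> = S)"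
          unfolding z2_law_def[symmetric] by measurable
        show "Measurable.pred (\<Pi>\<^sub>M e\<in>z2_edges. measure_pmf (bernoulli_pmf p)) (\<lambda>\<omega>. zconn (- S) \<omega> y z)"
          unfolding z2_law_def[symmetric] by measurable
      qed (auto simp: prob_space_measure_pmf)
      also have "\<dots> \<le> emeasure ?M {\<omega> \<in> space ?M. cluster_in B \<omega> = S} * tau p y z"
        unfolding tau_def by (intro mult_left_mono emeasure_mono) (auto intro: zconn_mono)
      finally show "emeasure ?M {\<omega> \<in> space ?M. cluster_in B \<omega> = S \<and> zconn (- S) \<omega> y z} \<le> \<dots>" .
    qed
    also have "\<dots> = (\<Sum>S\<in>{S. S \<subseteq> B \<and> x \<in> S}. emeasure ?M {\<omega> \<in> space ?M. cluster_in B \<omega> = S}) * tau p y z"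
      by (simp add: sum_distrib_right)
    \<comment> \<open>The events for different \<open>S\<close> are disjoint, and each with
      \<open>x\<close> in \<open>S\<close> forces \<open>0\<close> to be connected to
      \<open>x\<close>.\<close>
    also have "(\<Sum>S\<in>{S. S \<subseteq> B \<and> x \<in> S}. emeasure ?M {\<omega> \<in> space ?M. cluster_in B \<omega> = S})
        = emeasure ?M (\<Union>S\<in>{S. S \<subseteq> B \<and> x \<in> S}. {\<omega> \<in> space ?M. cluster_in B \<omega> = S})"
      by (rule sum_emeasure) (use fin in \<open>auto simp: disjoint_family_on_def\<close>)
    also have "\<dots> \<le> tau p 0 x"
      unfolding tau_def by (rule emeasure_mono) (auto simp: cluster_in_def intro: zconn_mono)
    finally show ?thesis by (simp add: mult_right_mono)
  qed
  have "tau p 0 z \<le> emeasure ?M (\<Union>i\<in>?I. ?G (fst i) (snd i))"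
    unfolding tau_def
  proof (rule emeasure_mono)
    show "{\<omega> \<in> space ?M. zconn UNIV \<omega> 0 z} \<subseteq> (\<Union>i\<in>?I. ?G (fst i) (snd i))"
    proof
      fix \<omega> assume "\<omega> \<in> {\<omega> \<in> space ?M. zconn UNIV \<omega> 0 z}"
      then have w: "\<omega> \<in> space ?M" "zconn UNIV \<omega> 0 z" by auto
      obtain x y where "x \<in> cluster_in B \<omega>" "y \<in> z2_nbrs x - B" "zconn (- cluster_in B \<omega>) \<omega> y z"
        using zconn_last_exit[OF B(2) z w(2)] by blast
      then show "\<omega> \<in> (\<Union>i\<in>?I. ?G (fst i) (snd i))"
        using w(1) cluster_in_subset[OF B(2), of \<omega>] by (intro UN_I[of "(x, y)"]) auto
    qed
  qed (use finI G in auto)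
  also have "\<dots> \<le> (\<Sum>i\<in>?I. emeasure ?M (?G (fst i) (snd i)))"
    by (rule emeasure_subadditive_finite) (use finI G in auto)
  also have "\<dots> = (\<Sum>x\<in>B. \<Sum>y\<in>z2_nbrs x - B. emeasure ?M (?G x y))"
    by (subst sum.Sigma) (use B finite_z2_nbrs in \<open>auto simp: split_beta\<close>)
  also have "\<dots> \<le> (\<Sum>x\<in>B. \<Sum>y\<in>z2_nbrs x - B. tau p 0 x * tau p y z)"
    by (intro sum_mono Gle)
  finally show ?thesis .
qed

text \<open>If every sphere carried at least 1/8, the first \<open>K\<close> spheres would force
  \<open>chi p\<close> to be at least \<open>K / 8\<close> for all \<open>K\<close>. The value 1/8
  is chosen so that it still leaves 1/2 after multiplication by the four neighbours of a
  site.\<close>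

lemma ex_small_sphere:
  assumes "chi p < \<infinity>"
  shows "\<exists>L. (\<Sum>x | znorm x = L. tau p 0 x) < ennreal (1 / 8)"
proof (rule ccontr)
  assume "\<not> ?thesis"
  then have ge: "ennreal (1 / 8) \<le> (\<Sum>x | znorm x = L. tau p 0 x)" for L
    by (simp add: not_less)
  have "ennreal (real K / 8) \<le> chi p" for K
  proof -
    have fin: "finite {x. znorm x < K}" by (rule finite_subset[OF _ finite_znorm_le[of K]]) auto
    have "ennreal (real K / 8) = (\<Sum>L<K. ennreal (1 / 8))"
      by (subst sum_ennreal) simp_all
    also have "\<dots> \<le> (\<Sum>L<K. \<Sum>x | x \<in> {x. znorm x < K} \<and> znorm x = L. tau p 0 x)"
    proof (rule sum_mono)
      fix L assume "L \<in> {..<K}"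
      then have "{x. x \<in> {x. znorm x < K} \<and> znorm x = L} = {x. znorm x = L}" by auto
      then show "ennreal (1 / 8) \<le> (\<Sum>x | x \<in> {x. znorm x < K} \<and> znorm x = L. tau p 0 x)"
        using ge[of L] by simp
    qed
    also have "\<dots> = (\<Sum>x | znorm x < K. tau p 0 x)"
      using fin by (intro sum.group) auto
    also have "\<dots> = (\<integral>\<^sup>+ x. tau p 0 x \<partial>count_space {x. znorm x < K})"
      using fin by (simp add: nn_integral_count_space_finite)
    also have "\<dots> = (\<integral>\<^sup>+ x. tau p 0 x * indicator {x. znorm x < K} x \<partial>count_space UNIV)"
      by (rule nn_integral_count_space_indicator) (simp add: NO_MATCH_def)
    also have "\<dots> \<le> chi p"
      unfolding chi_eq by (intro nn_integral_mono) (simp add: indicator_def)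
    finally show ?thesis .
  qed
  moreover obtain c where "chi p = ennreal c" "0 \<le> c"
    using assms by (cases "chi p") auto
  moreover obtain K where "8 * c < real K" using reals_Archimedean2 by blast
  ultimately have "ennreal (real K / 8) \<le> ennreal c" by metis
  with \<open>8 * c < real K\<close> \<open>0 \<le> c\<close> show False by simp
qed

text \<open>Iterate the exit inequality on the ball of radius \<open>L\<close>. An exit site
  \<open>y\<close> has norm at most \<open>L + 1\<close>, so \<open>z - y\<close> is still at
  distance \<open>k * (L + 1)\<close> from \<open>0\<close>, and each round gains 4 * 1/8 =
  1/2.\<close>

lemma tau_le_power:
  assumes L: "(\<Sum>x | znorm x = L. tau p 0 x) < ennreal (1 / 8)"
  shows "k * (L + 1) \<le> znorm z \<Longrightarrow> tau p 0 z \<le> ennreal ((1 / 2) ^ k)"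
proof (induction k arbitrary: z)
  case 0 then show ?case by (simp add: tau_le_1)
next
  case (Suc k)
  let ?B = "{x. znorm x \<le> L}"
  have z: "z \<notin> ?B" using Suc.prems by simp
  have "0 \<in> ?B" by (simp add: znorm_def)
  then have "tau p 0 z \<le> (\<Sum>x\<in>?B. \<Sum>y\<in>z2_nbrs x - ?B. tau p 0 x * tau p y z)"
    by (rule tau_le_exit[OF finite_znorm_le _ z])
  \<comment> \<open>Only sites on the sphere have neighbours outside the ball, and each has at most
    four.\<close>
  also have "\<dots> \<le> (\<Sum>x\<in>?B. if znorm x = L then tau p 0 x * ennreal (4 * (1 / 2) ^ k) else 0)"
  proof (rule sum_mono)
    fix x assume x: "x \<in> ?B"
    show "(\<Sum>y\<in>z2_nbrs x - ?B. tau p 0 x * tau p y z)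
        \<le> (if znorm x = L then tau p 0 x * ennreal (4 * (1 / 2) ^ k) else 0)"
    proof (cases "znorm x = L")
      case False
      then have "z2_nbrs x - ?B = {}" using x znorm_nbr[of _ x] by fastforce
      then show ?thesis by (simp only:) simp
    next
      case True
      have "tau p y z \<le> ennreal ((1 / 2) ^ k)" if "y \<in> z2_nbrs x - ?B" for y
      proof -
        have "znorm z \<le> znorm (z - y) + znorm y" using znorm_triangle[of "z - y" y] by simp
        moreover have "znorm y \<le> L + 1" using that True znorm_nbr[of y x] by auto
        ultimately have "k * (L + 1) \<le> znorm (z - y)" using Suc.prems by simp
        then show ?thesis using Suc.IH by (simp add: tau_diff[of p y z])
      qed
      then have "(\<Sum>y\<in>z2_nbrs x - ?B. tau p 0 x * tau p y z)
          \<le> (\<Sum>y\<in>z2_nbrs x - ?B. tau p 0 x * ennreal ((1 / 2) ^ k))"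
        by (intro sum_mono mult_left_mono) auto
      also have "\<dots> = of_nat (card (z2_nbrs x - ?B)) * (tau p 0 x * ennreal ((1 / 2) ^ k))"
        by simp
      also have "\<dots> \<le> of_nat 4 * (tau p 0 x * ennreal ((1 / 2) ^ k))"
        by (intro mult_right_mono of_nat_mono order_trans[OF card_mono card_z2_nbrs])
           (auto simp: finite_z2_nbrs)
      also have "\<dots> = tau p 0 x * ennreal (4 * (1 / 2) ^ k)"
        by (simp add: ennreal_mult mult.left_commute)
      finally show ?thesis using True by simp
    qed
  qed
  also have "\<dots> = (\<Sum>x | znorm x = L. tau p 0 x) * ennreal (4 * (1 / 2) ^ k)"
  proof -
    have "{x \<in> ?B. znorm x = L} = {x. znorm x = L}" by auto
    then show ?thesis
      by (simp add: sum.inter_filter[OF finite_znorm_le, symmetric] sum_distrib_right)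
  qed
  also have "\<dots> \<le> ennreal (1 / 8) * ennreal (4 * (1 / 2) ^ k)"
    using L by (intro mult_right_mono) auto
  also have "\<dots> = ennreal ((1 / 2) ^ Suc k)"
    by (subst ennreal_mult[symmetric]) auto
  finally show ?case .
qed

section \<open>Exponential moments of the two-point function\<close>

definition weighted_chi :: "real \<Rightarrow> real \<Rightarrow> ennreal" where
  "weighted_chi b p = (\<integral>\<^sup>+ x. ennreal (b ^ znorm x) * tau p 0 x \<partial>count_space UNIV)"

lemma weighted_chi_1: "weighted_chi 1 p = chi p"
  by (simp add: weighted_chi_def chi_eq)

text \<open>Sites are grouped by norm; the sphere of radius \<open>n\<close> is counted crudely by
  the whole square.\<close>

lemma nn_integral_znorm_le:
  "(\<integral>\<^sup>+ x. g (znorm x) \<partial>count_space UNIV) \<le> (\<Sum>n. ennreal ((2 * real n + 1)\<^sup>2) * g n)"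
proof -
  have "(\<integral>\<^sup>+ x. g (znorm x) \<partial>count_space UNIV)
      = (\<integral>\<^sup>+ x. (\<integral>\<^sup>+ n. g n * indicator {x. znorm x = n} x \<partial>count_space UNIV) \<partial>count_space UNIV)"
  proof (rule nn_integral_cong)
    fix x
    have "(\<integral>\<^sup>+ n. g n * indicator {x. znorm x = n} x \<partial>count_space UNIV)
        = (\<Sum>n\<in>{znorm x}. g n * indicator {x. znorm x = n} x)"
      by (rule nn_integral_count_space') auto
    then show "g (znorm x) = (\<integral>\<^sup>+ n. g n * indicator {x. znorm x = n} x \<partial>count_space UNIV)" by simp
  qed
  also have "\<dots> = (\<integral>\<^sup>+ n. (\<integral>\<^sup>+ x. g n * indicator {x. znorm x = n} x \<partial>count_space UNIV) \<partial>count_space UNIV)"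
    by (rule nn_integral_count_space_nn_integral) auto
  also have "\<dots> \<le> (\<integral>\<^sup>+ n. ennreal ((2 * real n + 1)\<^sup>2) * g n \<partial>count_space UNIV)"
  proof (rule nn_integral_mono)
    fix n
    have fin: "finite {x. znorm x = n}" by (rule finite_subset[OF _ finite_znorm_le[of n]]) auto
    have "card {x. znorm x = n} \<le> (2 * n + 1)\<^sup>2"
      unfolding card_znorm_le[symmetric] by (rule card_mono[OF finite_znorm_le]) auto
    then have "real (card {x. znorm x = n}) \<le> real ((2 * n + 1)\<^sup>2)"
      by (simp only: of_nat_le_iff)
    then have "real (card {x. znorm x = n}) \<le> (2 * real n + 1)\<^sup>2"
      by (simp only: of_nat_power of_nat_add of_nat_mult of_nat_numeral of_nat_1)
    then have "ennreal (real (card {x. znorm x = n})) \<le> ennreal ((2 * real n + 1)\<^sup>2)"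
      by (rule ennreal_leI)
    then have "g n * of_nat (card {x. znorm x = n}) \<le> ennreal ((2 * real n + 1)\<^sup>2) * g n"
      by (simp add: ennreal_of_nat_eq_real_of_nat mult.commute mult_left_mono)
    moreover have "(\<integral>\<^sup>+ x. g n * indicator {x. znorm x = n} x \<partial>count_space UNIV) = g n * of_nat (card {x. znorm x = n})"
      using fin by (subst nn_integral_cmult_indicator) auto
    ultimately show "(\<integral>\<^sup>+ x. g n * indicator {x. znorm x = n} x \<partial>count_space UNIV)
        \<le> ennreal ((2 * real n + 1)\<^sup>2) * g n" by simp
  qed
  also have "\<dots> = (\<Sum>n. ennreal ((2 * real n + 1)\<^sup>2) * g n)"
    by (rule nn_integral_count_space_nat)
  finally show ?thesis .
qed

lemma ex_weighted_chi_finite: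
  assumes "chi p < \<infinity>"
  shows "\<exists>b>1. weighted_chi b p < \<infinity>"
proof -
  obtain L where L: "(\<Sum>x | znorm x = L. tau p 0 x) < ennreal (1 / 8)"
    using ex_small_sphere[OF assms] by blast
  \<comment> \<open>With \<open>b ^ (4 * (L + 1)) = 2\<close> the decay of \<open>tau\<close> is of
    order \<open>b ^ (-4 n)\<close> at norm \<open>n\<close>. One power \<open>b ^ n\<close> pays
    for the weight and two pay for the polynomial count of sites, which leaves a geometric series of
    ratio \<open>1 / b\<close>.\<close>
  define b :: real where "b = root (4 * (L + 1)) 2"
  have b1: "1 < b" by (simp add: b_def)
  have bL: "b ^ (4 * (L + 1)) = 2" unfolding b_def by (rule real_root_pow_pos2) auto
  \<comment> \<open>\<open>K\<close> is chosen so that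
    \<open>2 * n + 1 \<le> K * (1 + n * (b - 1))\<close>, and Bernoulli's inequality bounds the
    right side by \<open>K * b ^ n\<close>.\<close>
  define K where "K = 1 + 2 / (b - 1)"
  have poly: "(2 * real n + 1)\<^sup>2 \<le> K\<^sup>2 * b ^ (2 * n)" for n
  proof -
    have "K * (1 + real n * (b - 1)) = K + real n * (b - 1) + 2 * real n"
      using b1 by (simp add: K_def field_simps)
    moreover have "1 \<le> K" "0 \<le> real n * (b - 1)" using b1 by (auto simp: K_def)
    ultimately have "2 * real n + 1 \<le> K * (1 + real n * (b - 1))" by linarith
    also have "\<dots> \<le> K * b ^ n"
      using Bernoulli_inequality[of "b - 1" n] b1 \<open>1 \<le> K\<close> by (intro mult_left_mono) auto
    finally have "(2 * real n + 1)\<^sup>2 \<le> (K * b ^ n)\<^sup>2" by (intro power_mono) auto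
    then show ?thesis by (simp add: power_mult_distrib power_mult[symmetric] mult.commute)
  qed
  \<comment> \<open>Rounding the norm down to a multiple of \<open>L + 1\<close> costs the factor
    2.\<close>
  have decay: "b ^ znorm z * (1 / 2) ^ (znorm z div (L + 1)) \<le> 2 / b ^ (3 * znorm z)" for z
  proof -
    let ?k = "znorm z div (L + 1)"
    have "znorm z \<le> (L + 1) * (?k + 1)"
    proof -
      have "znorm z mod (L + 1) < L + 1" by simp
      moreover have "(L + 1) * ?k + znorm z mod (L + 1) = znorm z" by (rule mult_div_mod_eq)
      moreover have "(L + 1) * (?k + 1) = (L + 1) * ?k + (L + 1)" by simp
      ultimately show ?thesis by linarith
    qed
    then have "b ^ (4 * znorm z) \<le> b ^ (4 * (L + 1) * (?k + 1))"
      using b1 by (intro power_increasing) (simp_all only: mult.assoc mult_le_mono2 less_imp_le)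
    also have "\<dots> = 2 ^ (?k + 1)" by (subst power_mult) (simp only: bL)
    finally have "b ^ (4 * znorm z) \<le> 2 * 2 ^ ?k" by simp
    moreover have "b ^ (4 * znorm z) = b ^ znorm z * b ^ (3 * znorm z)" by (simp flip: power_add)
    ultimately have "b ^ znorm z * b ^ (3 * znorm z) \<le> 2 * 2 ^ ?k" by simp
    moreover have "X * (1 / P) \<le> 2 / Y" if "X * Y \<le> 2 * P" "0 < Y" "0 < P" for X Y P :: real
      using that by (simp add: field_simps)
    ultimately have "b ^ znorm z * (1 / 2 ^ ?k) \<le> 2 / b ^ (3 * znorm z)" using b1 by simp
    then show ?thesis by (simp only: power_one_over)
  qed
  have "weighted_chi b p \<le> (\<integral>\<^sup>+ x. ennreal (2 / b ^ (3 * znorm x)) \<partial>count_space UNIV)"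
    unfolding weighted_chi_def
  proof (rule nn_integral_mono)
    fix x
    have "tau p 0 x \<le> ennreal ((1 / 2) ^ (znorm x div (L + 1)))"
      by (rule tau_le_power[OF L div_times_less_eq_dividend])
    then have "ennreal (b ^ znorm x) * tau p 0 x \<le> ennreal (b ^ znorm x) * ennreal ((1 / 2) ^ (znorm x div (L + 1)))"
      by (rule mult_left_mono) simp
    also have "\<dots> = ennreal (b ^ znorm x * (1 / 2) ^ (znorm x div (L + 1)))"
      using b1 by (intro ennreal_mult[symmetric]) auto
    also have "\<dots> \<le> ennreal (2 / b ^ (3 * znorm x))"
      by (rule ennreal_leI[OF decay])
    finally show "ennreal (b ^ znorm x) * tau p 0 x \<le> \<dots>" .
  qed
  also have "\<dots> \<le> (\<Sum>n. ennreal ((2 * real n + 1)\<^sup>2) * ennreal (2 / b ^ (3 * n)))"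
    by (rule nn_integral_znorm_le)
  also have "\<dots> \<le> (\<Sum>n. ennreal (2 * K\<^sup>2 * (1 / b) ^ n))"
  proof (rule suminf_le)
    fix n
    have "ennreal ((2 * real n + 1)\<^sup>2) * ennreal (2 / b ^ (3 * n)) = ennreal ((2 * real n + 1)\<^sup>2 * (2 / b ^ (3 * n)))"
      using b1 by (intro ennreal_mult[symmetric]) auto
    also have "\<dots> \<le> ennreal (2 * K\<^sup>2 * (1 / b) ^ n)"
    proof (rule ennreal_leI)
      have "(2 * real n + 1)\<^sup>2 * (2 / b ^ (3 * n)) \<le> K\<^sup>2 * b ^ (2 * n) * (2 / b ^ (3 * n))"
        using b1 by (intro mult_right_mono poly) auto
      also have "\<dots> = K\<^sup>2 * b ^ (2 * n) * (2 / (b ^ (2 * n) * b ^ n))" by (simp flip: power_add)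
      also have "\<dots> = 2 * K\<^sup>2 * (1 / b) ^ n"
      proof -
        have "K\<^sup>2 * X * (2 / (X * Y)) = 2 * K\<^sup>2 * (1 / Y)" if "0 < X" "0 < Y" for X Y :: real
          using that by (simp add: field_simps)
        then show ?thesis using b1 by (simp add: power_one_over)
      qed
      finally show "(2 * real n + 1)\<^sup>2 * (2 / b ^ (3 * n)) \<le> 2 * K\<^sup>2 * (1 / b) ^ n" .
    qed
    finally show "ennreal ((2 * real n + 1)\<^sup>2) * ennreal (2 / b ^ (3 * n)) \<le> \<dots>" .
  qed auto
  also have "\<dots> = ennreal (\<Sum>n. 2 * K\<^sup>2 * (1 / b) ^ n)"
    using b1 by (intro suminf_ennreal2 summable_mult summable_geometric) auto
  also have "\<dots> < \<infinity>" by simp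
  finally show ?thesis using b1 by blast
qed

section \<open>Entered sites\<close>

declare split_paired_Ex [simp del]

definition layer_edge :: "nat \<Rightarrow> (int \<times> int) set \<Rightarrow> edge" where
  "layer_edge n e = Flat ((\<lambda>x. (x, n)) ` e)"

definition layer_conn :: "(edge \<Rightarrow> bool) \<Rightarrow> nat \<Rightarrow> int \<times> int \<Rightarrow> int \<times> int \<Rightarrow> bool" where
  "layer_conn \<omega> n = zconn UNIV (\<lambda>e. \<omega> (layer_edge n e))"

fun up_steps :: "int \<times> int \<Rightarrow> (int \<times> int) set" where
  "up_steps (a, b) = {(a, b), (a - 1, b), (a, b - 1), (a - 1, b - 1)}"

text \<open>A site counts as entered when it is where a path arrives in its layer, before any
  horizontal move there; the origin starts layer 0. Entry and exit sites of the previous layer form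
  one pair \<open>q\<close>, a single countable index for the union bound.\<close>

fun entered :: "(edge \<Rightarrow> bool) \<Rightarrow> nat \<Rightarrow> int \<times> int \<Rightarrow> bool" where
  "entered \<omega> 0 y \<longleftrightarrow> y = 0"
| "entered \<omega> (Suc n) y \<longleftrightarrow> (\<exists>q. entered \<omega> n (fst q) \<and> layer_conn \<omega> n (fst q) (snd q)
     \<and> y \<in> up_steps (snd q) \<and> \<omega> (Up (snd q, n) (y, Suc n)))"

lemma up_nbrs_eq: "up_nbrs (x, n) = (\<lambda>y. (y, Suc n)) ` up_steps x"
  by (cases x) auto

lemma finite_up_steps: "finite (up_steps x)"
  by (cases x) auto

lemma card_up_steps: "card (up_steps x) \<le> 4"
proof (cases x)
  case (Pair a b)
  then show ?thesis
    using card_length[of "[(a, b), (a - 1, b), (a, b - 1), (a - 1, b - 1)]"] by simp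
qed

lemma znorm_up_steps: "y \<in> up_steps x \<Longrightarrow> znorm y \<le> znorm x + 1"
  by (cases x; cases y) (auto simp: znorm_def)

lemma layer_edge_in_edges: "e \<in> z2_edges \<Longrightarrow> layer_edge n e \<in> edges"
proof -
  assume "e \<in> z2_edges"
  then obtain x y where e: "e = {x, y}" "y \<in> z2_nbrs x" unfolding z2_edges_def by blast
  then have "layer_edge n e = Flat {(x, n), (y, n)}" "(y, n) \<in> flat_nbrs (x, n)" by (simp_all add: layer_edge_def)
  then show "layer_edge n e \<in> edges" unfolding edges_def by blast
qed

lemma Up_in_edges: "y \<in> up_steps x \<Longrightarrow> Up (x, n) (y, Suc n) \<in> edges"
proof -
  assume "y \<in> up_steps x"
  then have "(y, Suc n) \<in> up_nbrs (x, n)" unfolding up_nbrs_eq by (rule imageI)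
  then show ?thesis unfolding edges_def by blast
qed

lemma layer_edge_eq_iff: "e \<in> z2_edges \<Longrightarrow> layer_edge n e = layer_edge m e' \<longleftrightarrow> n = m \<and> e = e'"
proof
  assume e: "e \<in> z2_edges" and eq: "layer_edge n e = layer_edge m e'"
  then obtain x where "x \<in> e" unfolding z2_edges_def by blast
  moreover have im: "(\<lambda>x. (x, n)) ` e = (\<lambda>x. (x, m)) ` e'" using eq by (simp add: layer_edge_def)
  ultimately have "(x, n) \<in> (\<lambda>x. (x, m)) ` e'" by blast
  then have "n = m" by blast
  moreover have "inj (\<lambda>x :: int \<times> int. (x, m))" by (simp add: inj_def)
  ultimately show "n = m \<and> e = e'" using im by (simp add: inj_image_eq_iff)
qed simp

lemma determined_layer_conn: "determined (layer_edge n ` z2_edges) (\<lambda>\<omega>. layer_conn \<omega> n x y)"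
  unfolding determined_def layer_conn_def
proof (intro allI impI)
  fix \<omega> \<omega>' :: "edge \<Rightarrow> bool"
  assume "\<forall>i\<in>layer_edge n ` z2_edges. \<omega> i = \<omega>' i"
  then show "zconn UNIV (\<lambda>e. \<omega> (layer_edge n e)) x y = zconn UNIV (\<lambda>e. \<omega>' (layer_edge n e)) x y"
    using determined_zconn[of UNIV x y] unfolding determined_def by simp
qed

definition below :: "nat \<Rightarrow> edge set" where
  "below n = {Up v w | v w. snd v < n} \<union> (\<Union>m<n. layer_edge m ` z2_edges)"

lemma below_mono: "below n \<subseteq> below (Suc n)"
  unfolding below_def by (intro Un_mono UN_mono Collect_mono) (auto intro: less_SucI)

text \<open>Entry into layer \<open>n\<close> is decided by the layers before it, hence
  independently of the horizontal edges of layer \<open>n\<close> and of the upward edges leaving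
  it.\<close>

lemma determined_entered: "determined (below n) (\<lambda>\<omega>. entered \<omega> n y)"
proof (induction n arbitrary: y)
  case 0 then show ?case by (simp add: determined_def)
next
  case (Suc n)
  have 1: "determined (below (Suc n)) (\<lambda>\<omega>. entered \<omega> n x)" for x
    by (rule determined_mono[OF Suc.IH]) (rule below_mono)
  have 2: "determined (below (Suc n)) (\<lambda>\<omega>. layer_conn \<omega> n x x')" for x x'
    by (rule determined_mono[OF determined_layer_conn]) (auto simp: below_def)
  show ?case
    unfolding determined_def entered.simps
  proof (intro allI impI)
    fix \<omega> \<omega>' :: "edge \<Rightarrow> bool"
    assume eq: "\<forall>i\<in>below (Suc n). \<omega> i = \<omega>' i"
    have "entered \<omega> n x = entered \<omega>' n x" for x using 1[of x] eq unfolding determined_def by blast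
    moreover have "layer_conn \<omega> n x x' = layer_conn \<omega>' n x x'" for x x'
      using 2[of x x'] eq unfolding determined_def by blast
    moreover have "\<omega> (Up (x, n) w) = \<omega>' (Up (x, n) w)" for x w
    proof -
      have "Up (x, n) w \<in> below (Suc n)" unfolding below_def by (intro UnI1 CollectI exI[of _ "(x, n)"] exI[of _ w] conjI) simp_all
      then show ?thesis using eq by blast
    qed
    ultimately show "(\<exists>q. entered \<omega> n (fst q) \<and> layer_conn \<omega> n (fst q) (snd q) \<and> y \<in> up_steps (snd q) \<and> \<omega> (Up (snd q, n) (y, Suc n)))
      \<longleftrightarrow> (\<exists>q. entered \<omega>' n (fst q) \<and> layer_conn \<omega>' n (fst q) (snd q) \<and> y \<in> up_steps (snd q) \<and> \<omega>' (Up (snd q, n) (y, Suc n)))"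
      by simp
  qed
qed

section \<open>Infinite open paths in terms of entered sites\<close>

lemma layer_conn_refl: "layer_conn \<omega> n x x"
  by (simp add: layer_conn_def zconn_def)

lemma layer_conn_step: "layer_conn \<omega> n x y \<Longrightarrow> z \<in> z2_nbrs y \<Longrightarrow> \<omega> (layer_edge n {y, z}) \<Longrightarrow> layer_conn \<omega> n x z"
  unfolding layer_conn_def zconn_def by (rule rtranclp.rtrancl_into_rtrancl) auto

lemma open_step_flat: "open_step \<omega> (x, n) (y, n) \<Longrightarrow> y \<in> z2_nbrs x \<and> \<omega> (layer_edge n {x, y})"
  by (auto simp: open_step_def up_nbrs_eq layer_edge_def)

lemma open_step_up: "open_step \<omega> (x, n) (y, Suc n) \<Longrightarrow> y \<in> up_steps x \<and> \<omega> (Up (x, n) (y, Suc n))"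
  by (auto simp: open_step_def up_nbrs_eq)

lemma open_step_level: "open_step \<omega> v w \<Longrightarrow> snd w = snd v \<or> snd w = Suc (snd v)"
  by (cases v) (auto simp: open_step_def up_nbrs_eq)

lemma entered_Suc_I:
  "entered \<omega> n x \<Longrightarrow> layer_conn \<omega> n x x' \<Longrightarrow> y \<in> up_steps x' \<Longrightarrow> \<omega> (Up (x', n) (y, Suc n)) \<Longrightarrow> entered \<omega> (Suc n) y"
  unfolding entered.simps by (rule exI[of _ "(x, x')"]) simp

lemma entered_downward: "entered \<omega> n y \<Longrightarrow> m \<le> n \<Longrightarrow> \<exists>x. entered \<omega> m x"
proof (induction n arbitrary: y)
  case (Suc n)
  show ?case
  proof (cases "m = Suc n")
    case False
    obtain x where "entered \<omega> n x" using Suc.prems(1) unfolding entered.simps by blast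
    then show ?thesis using Suc False by auto
  qed (use Suc.prems in blast)
qed blast

text \<open>The height never decreases along an open path. If it is unbounded, every layer is
  entered; if it is bounded, it is eventually constant, and injectivity puts infinitely many sites
  into one horizontal cluster.\<close>

lemma percolates_split:
  assumes "percolates \<omega>"
  shows "(\<forall>n. \<exists>x. entered \<omega> n x) \<or> (\<exists>n x. infinite {y. layer_conn \<omega> n x y})"
proof -
  obtain v where v: "v 0 = origin" "inj v" "\<And>k. open_step \<omega> (v k) (v (Suc k))"
    using assms unfolding percolates_def by blast
  \<comment> \<open>Invariant: each visited site is joined within its layer to a site where that
    layer was entered.\<close>
  have reach: "\<exists>x0. entered \<omega> (snd (v k)) x0 \<and> layer_conn \<omega> (snd (v k)) x0 (fst (v k))" for k
  proof (induction k)
    case 0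
    then show ?case using v(1) layer_conn_refl by (auto simp: zero_prod_def)
  next
    case (Suc k)
    then obtain x0 where x0: "entered \<omega> (snd (v k)) x0" "layer_conn \<omega> (snd (v k)) x0 (fst (v k))" by blast
    obtain x n where k: "v k = (x, n)" by (cases "v k")
    obtain y m where Sk: "v (Suc k) = (y, m)" by (cases "v (Suc k)")
    have os: "open_step \<omega> (x, n) (y, m)" using v(3)[of k] k Sk by simp
    then consider "m = n" | "m = Suc n" using open_step_level by fastforce
    then show ?case
    proof cases
      case 1
      then have "layer_conn \<omega> n x0 y"
        using open_step_flat[of \<omega> x n y] os x0(2) k layer_conn_step[of \<omega> n x0 x y] by simp
      then show ?thesis using 1 x0 k Sk by auto
    next
      case 2
      then have "entered \<omega> m y"
        using open_step_up[of \<omega> x n y] os x0 k entered_Suc_I[of \<omega> n x0 x y] by (simp del: entered.simps)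
      then show ?thesis using Sk layer_conn_refl[of \<omega> m y] by auto
    qed
  qed
  have mono: "snd (v k) \<le> snd (v (Suc k))" for k
    using open_step_level[OF v(3)[of k]] by auto
  show ?thesis
  proof (cases "\<forall>n. \<exists>k. n \<le> snd (v k)")
    case True
    then show ?thesis using reach entered_downward by blast
  next
    case False
    then obtain N where N: "\<And>k. snd (v k) < N" by (meson not_le)
    \<comment> \<open>\<open>k0\<close> is a time of maximal height, after which monotonicity keeps
      the height constant; \<open>True\<close> fills the predicate of the maximum principle.\<close>
    then have "\<exists>k0. True \<and> (\<forall>k. True \<longrightarrow> snd (v k) \<le> snd (v k0))"
      by (intro ex_has_greatest_nat[of _ 0 _ N]) simp_all
    then obtain k0 where k0: "\<And>k. snd (v k) \<le> snd (v k0)" by blast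
    let ?n = "snd (v k0)" and ?x = "fst (v k0)"
    have "snd (v (k0 + j)) = ?n \<and> layer_conn \<omega> ?n ?x (fst (v (k0 + j)))" for j
    proof (induction j)
      case 0 then show ?case by (simp add: layer_conn_refl)
    next
      case (Suc j)
      have n: "snd (v (Suc (k0 + j))) = ?n"
        using Suc mono[of "k0 + j"] k0[of "Suc (k0 + j)"] by simp
      have "open_step \<omega> (fst (v (k0 + j)), ?n) (fst (v (Suc (k0 + j))), ?n)"
        using v(3)[of "k0 + j"] Suc.IH n by (metis prod.collapse)
      then have "layer_conn \<omega> ?n ?x (fst (v (Suc (k0 + j))))"
        using open_step_flat layer_conn_step Suc.IH by blast
      then show ?case using n by simp
    qed
    then have sub: "range (\<lambda>j. v (k0 + j)) \<subseteq> {y. layer_conn \<omega> ?n ?x y} \<times> {?n}"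
      unfolding image_subset_iff mem_Times_iff by simp
    have "inj (\<lambda>j. v (k0 + j))" using inj_compose[OF v(2), of "(+) k0"] by (simp add: comp_def)
    then have "infinite (range (\<lambda>j. v (k0 + j)))" using finite_imageD by blast
    then have "infinite {y. layer_conn \<omega> ?n ?x y}" using finite_subset[OF sub] by blast
    then show ?thesis by blast
  qed
qed

section \<open>Fixed layer types\<close>

lemma emeasure_bernoulli_True:
  "0 \<le> p \<Longrightarrow> p \<le> 1 \<Longrightarrow> emeasure (measure_pmf (bernoulli_pmf p)) {True} = ennreal p"
  by (simp add: emeasure_pmf_single)

locale environment =
  fixes p_g p_b p_h :: real and \<eta> :: "nat \<Rightarrow> bool"
  assumes p_b: "0 \<le> p_b" "p_b \<le> 1" and p_g: "0 \<le> p_g" "p_g \<le> 1"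
begin

definition up_prob :: "nat \<Rightarrow> real" where
  "up_prob n = (if \<eta> n then p_b else p_g)"

abbreviation "E \<equiv> edge_law p_g p_b p_h \<eta>"

abbreviation edge_marginal :: "edge \<Rightarrow> bool measure" where
  "edge_marginal e \<equiv> measure_pmf (bernoulli_pmf (open_prob p_g p_b p_h \<eta> e))"

definition reach :: "nat \<Rightarrow> int \<times> int \<Rightarrow> ennreal" where
  "reach n x = emeasure E {\<omega> \<in> space E. entered \<omega> n x}"

text \<open>For \<open>b = 1\<close> this is the expected number of entered sites of layer
  \<open>n\<close>; for \<open>b > 1\<close> it also controls how far out they lie.\<close>

definition weight :: "real \<Rightarrow> nat \<Rightarrow> ennreal" where
  "weight b n = (\<integral>\<^sup>+ x. ennreal (b ^ znorm x) * reach n x \<partial>count_space UNIV)"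

lemma up_prob: "0 \<le> up_prob n" "up_prob n \<le> 1"
  using p_b p_g by (auto simp: up_prob_def)

sublocale prob_space E
  by (rule prob_space_edge_law)

lemma prob_space_edge_marginal: "prob_space (edge_marginal e)"
  by (rule prob_space_measure_pmf)

lemma conn_law:
  shows emeasure_layer_conn: "emeasure E {\<omega> \<in> space E. layer_conn \<omega> n x y} = tau p_h x y"
    and measurable_layer_conn [measurable]: "Measurable.pred E (\<lambda>\<omega>. layer_conn \<omega> n x y)"
proof -
  have inj: "inj_on (layer_edge n) z2_edges" by (rule inj_onI) (simp add: layer_edge_eq_iff)
  have layer_edge: "layer_edge n \<in> z2_edges \<rightarrow> edges" by (simp add: layer_edge_in_edges)
  have marg: "edge_marginal (layer_edge n e) = measure_pmf (bernoulli_pmf p_h)" for e by (simp add: layer_edge_def)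
  show "emeasure E {\<omega> \<in> space E. layer_conn \<omega> n x y} = tau p_h x y" "Measurable.pred E (\<lambda>\<omega>. layer_conn \<omega> n x y)"
    unfolding layer_conn_def edge_law_def
    using emeasure_PiM_zconn[where M = edge_marginal, OF prob_space_edge_marginal inj layer_edge marg] by auto
qed

lemma measurable_edge: "e \<in> edges \<Longrightarrow> Measurable.pred E (\<lambda>\<omega>. \<omega> e)"
  by (subst measurable_cong_sets[OF sets_edge_law refl]) (rule measurable_component_singleton)

lemma measurable_up [measurable]: "Measurable.pred E (\<lambda>\<omega>. y \<in> up_steps x \<and> \<omega> (Up (x, n) (y, Suc n)))"
  by (cases "y \<in> up_steps x") (simp_all add: measurable_edge Up_in_edges)

lemma measurable_entered [measurable]: "Measurable.pred E (\<lambda>\<omega>. entered \<omega> n y)"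
proof (induction n arbitrary: y)
  case (Suc n)
  note Suc[measurable]
  show ?case unfolding entered.simps by measurable
qed simp

lemma emeasure_edge:
  assumes "e \<in> edges"
  shows "emeasure E {\<omega> \<in> space E. \<omega> e} = emeasure (edge_marginal e) {True}"
proof -
  interpret P: product_prob_space edge_marginal edges
    by (rule product_prob_spaceI) (rule prob_space_edge_marginal)
  show ?thesis using P.emeasure_PiM_Collect_single[OF assms, of "{True}"]
    by (simp add: edge_law_def)
qed

lemma emeasure_up:
  "emeasure E {\<omega> \<in> space E. y \<in> up_steps x \<and> \<omega> (Up (x, n) (y, Suc n))}
    = ennreal (up_prob n) * indicator (up_steps x) y"
proof (cases "y \<in> up_steps x")
  case True
  then show ?thesis
    using emeasure_edge[OF Up_in_edges[OF True, of n]] emeasure_bernoulli_True[OF up_prob, of n]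
    by (simp add: up_prob_def)
qed simp

lemma emeasure_conj:
  assumes "Measurable.pred E P" "determined J P" "Measurable.pred E Q" "determined K Q" "J \<inter> K = {}"
  shows "emeasure E {\<omega> \<in> space E. P \<omega> \<and> Q \<omega>} = emeasure E {\<omega> \<in> space E. P \<omega>} * emeasure E {\<omega> \<in> space E. Q \<omega>}"
  using assms unfolding edge_law_def
  by (intro emeasure_PiM_conj prob_space_edge_marginal) auto

text \<open>The three events live on disjoint sets of edges: those below layer \<open>n\<close>, the
  horizontal edges of layer \<open>n\<close>, and one upward edge.\<close>

lemma emeasure_ent_conn_up:
  "emeasure E {\<omega> \<in> space E. entered \<omega> n x \<and> layer_conn \<omega> n x x' \<and> y \<in> up_steps x' \<and> \<omega> (Up (x', n) (y, Suc n))}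
    = reach n x * (tau p_h x x' * (ennreal (up_prob n) * indicator (up_steps x') y))"
proof -
  let ?U = "\<lambda>\<omega>. y \<in> up_steps x' \<and> \<omega> (Up (x', n) (y, Suc n))"
  have U: "determined {Up (x', n) (y, Suc n)} ?U" by (simp add: determined_def)
  have CU: "determined (layer_edge n ` z2_edges \<union> {Up (x', n) (y, Suc n)}) (\<lambda>\<omega>. layer_conn \<omega> n x x' \<and> ?U \<omega>)"
    by (intro determined_conj determined_mono[OF determined_layer_conn] determined_mono[OF U]) auto
  have disj: "below n \<inter> (layer_edge n ` z2_edges \<union> {Up (x', n) (y, Suc n)}) = {}"
    by (auto simp: below_def layer_edge_eq_iff) (auto simp: layer_edge_def)
  have "emeasure E {\<omega> \<in> space E. entered \<omega> n x \<and> layer_conn \<omega> n x x' \<and> ?U \<omega>}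
      = reach n x * emeasure E {\<omega> \<in> space E. layer_conn \<omega> n x x' \<and> ?U \<omega>}"
    unfolding reach_def by (rule emeasure_conj[OF _ determined_entered _ CU disj]) measurable
  also have "emeasure E {\<omega> \<in> space E. layer_conn \<omega> n x x' \<and> ?U \<omega>}
      = tau p_h x x' * emeasure E {\<omega> \<in> space E. ?U \<omega>}"
    unfolding emeasure_layer_conn[of n, symmetric]
    by (rule emeasure_conj[OF _ determined_layer_conn _ U]) (measurable, auto simp: layer_edge_def)
  finally show ?thesis by (simp only: emeasure_up)
qed

lemma reach_0: "reach 0 x = indicator {0} x"
  using emeasure_space_1 by (simp add: reach_def indicator_def)

lemma reach_le_1: "reach n x \<le> 1"
  unfolding reach_def by (rule emeasure_le_1)

lemma reach_Suc_le:
  "reach (Suc n) y \<le> (\<integral>\<^sup>+ q. reach n (fst q) * (tau p_h (fst q) (snd q)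
     * (ennreal (up_prob n) * indicator (up_steps (snd q)) y)) \<partial>count_space UNIV)"
proof -
  have "reach (Suc n) y \<le> (\<integral>\<^sup>+ q. emeasure E {\<omega> \<in> space E. entered \<omega> n (fst q) \<and> layer_conn \<omega> n (fst q) (snd q)
      \<and> y \<in> up_steps (snd q) \<and> \<omega> (Up (snd q, n) (y, Suc n))} \<partial>count_space UNIV)"
    unfolding reach_def entered.simps by (rule emeasure_le_nn_integral_union) measurable
  then show ?thesis by (simp only: emeasure_ent_conn_up)
qed

section \<open>Growth of the weights from layer to layer\<close>

lemma weight_0: "weight b 0 = 1"
proof -
  have "weight b 0 = (\<Sum>x\<in>{0}. ennreal (b ^ znorm x) * reach 0 x)"
    unfolding weight_def by (rule nn_integral_count_space') (auto simp: reach_0)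
  then show ?thesis by (simp add: reach_0 znorm_def)
qed

lemma nn_integral_up_steps_le:
  assumes "1 \<le> b"
  shows "(\<integral>\<^sup>+ y. ennreal (b ^ znorm y) * indicator (up_steps x) y \<partial>count_space UNIV) \<le> ennreal (4 * b * b ^ znorm x)"
proof -
  have "(\<integral>\<^sup>+ y. ennreal (b ^ znorm y) * indicator (up_steps x) y \<partial>count_space UNIV)
      = (\<Sum>y\<in>up_steps x. ennreal (b ^ znorm y) * indicator (up_steps x) y)"
    by (rule nn_integral_count_space') (auto simp: finite_up_steps)
  also have "\<dots> \<le> (\<Sum>y\<in>up_steps x. ennreal (b * b ^ znorm x))"
  proof (rule sum_mono)
    fix y assume y: "y \<in> up_steps x"
    have "b ^ znorm y \<le> b ^ (znorm x + 1)" using znorm_up_steps[OF y] assms by (rule power_increasing)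
    then show "ennreal (b ^ znorm y) * indicator (up_steps x) y \<le> ennreal (b * b ^ znorm x)"
      using y by (simp add: ennreal_leI)
  qed
  also have "\<dots> = ennreal (real (card (up_steps x))) * ennreal (b * b ^ znorm x)"
    by (simp add: ennreal_of_nat_eq_real_of_nat)
  also have "\<dots> = ennreal (real (card (up_steps x)) * (b * b ^ znorm x))"
    using assms by (intro ennreal_mult[symmetric]) auto
  also have "\<dots> \<le> ennreal (4 * (b * b ^ znorm x))"
    using assms card_up_steps[of x] by (intro ennreal_leI mult_right_mono) auto
  finally show ?thesis by (simp add: mult.assoc)
qed

text \<open>Translate \<open>x\<close> to \<open>0\<close>; by the triangle inequality the weight is
  submultiplicative.\<close>

lemma weight_tau_le:
  assumes "1 \<le> b"
  shows "(\<integral>\<^sup>+ y. ennreal (b ^ znorm y) * tau p_h x y \<partial>count_space UNIV) \<le> ennreal (b ^ znorm x) * weighted_chi b p_h"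
proof -
  have bij: "bij_betw (\<lambda>z. x + z) UNIV UNIV" by (rule bij_betw_byWitness[of _ "\<lambda>z. z - x"]) auto
  have "(\<integral>\<^sup>+ y. ennreal (b ^ znorm y) * tau p_h x y \<partial>count_space UNIV)
      = (\<integral>\<^sup>+ z. ennreal (b ^ znorm (x + z)) * tau p_h x (x + z) \<partial>count_space UNIV)"
    by (rule nn_integral_bij_count_space[OF bij, symmetric])
  also have "\<dots> \<le> (\<integral>\<^sup>+ z. ennreal (b ^ znorm x) * (ennreal (b ^ znorm z) * tau p_h 0 z) \<partial>count_space UNIV)"
  proof (rule nn_integral_mono)
    fix z
    have "b ^ znorm (x + z) \<le> b ^ (znorm x + znorm z)" using znorm_triangle assms by (rule power_increasing)
    then have "ennreal (b ^ znorm (x + z)) \<le> ennreal (b ^ znorm x * b ^ znorm z)"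
      by (intro ennreal_leI) (simp add: power_add)
    also have "\<dots> = ennreal (b ^ znorm x) * ennreal (b ^ znorm z)" using assms by (intro ennreal_mult) auto
    finally show "ennreal (b ^ znorm (x + z)) * tau p_h x (x + z) \<le> ennreal (b ^ znorm x) * (ennreal (b ^ znorm z) * tau p_h 0 z)"
      by (simp add: tau_diff[of p_h x] mult_right_mono flip: mult.assoc)
  qed
  also have "\<dots> = ennreal (b ^ znorm x) * weighted_chi b p_h"
    unfolding weighted_chi_def by (rule nn_integral_cmult) simp
  finally show ?thesis .
qed

text \<open>Apply the union bound over entry and exit sites, then sum from the top down. The arrival
  contributes \<open>4 * b\<close>, for four steps each raising the norm by at most one; the upward
  edge contributes its probability; the horizontal connection contributes
  \<open>weighted_chi b p_h\<close>.\<close>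

lemma weight_Suc_le:
  assumes b: "1 \<le> b"
  shows "weight b (Suc n) \<le> ennreal (4 * b * up_prob n) * weighted_chi b p_h * weight b n"
proof -
  let ?c = "\<lambda>q. reach n (fst q) * (tau p_h (fst q) (snd q) * ennreal (up_prob n))"
  have "weight b (Suc n) \<le> (\<integral>\<^sup>+ y. (\<integral>\<^sup>+ q. ?c q * (ennreal (b ^ znorm y) * indicator (up_steps (snd q)) y)
      \<partial>count_space UNIV) \<partial>count_space UNIV)"
    unfolding weight_def
  proof (rule nn_integral_mono)
    fix y
    have "ennreal (b ^ znorm y) * reach (Suc n) y \<le> ennreal (b ^ znorm y) * (\<integral>\<^sup>+ q. reach n (fst q) * (tau p_h (fst q) (snd q)
     * (ennreal (up_prob n) * indicator (up_steps (snd q)) y)) \<partial>count_space UNIV)"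
      by (intro mult_left_mono reach_Suc_le) simp
    also have "\<dots> = (\<integral>\<^sup>+ q. ?c q * (ennreal (b ^ znorm y) * indicator (up_steps (snd q)) y) \<partial>count_space UNIV)"
      by (subst nn_integral_cmult[symmetric]) (auto intro!: nn_integral_cong simp: mult_ac)
    finally show "ennreal (b ^ znorm y) * reach (Suc n) y \<le> \<dots>" .
  qed
  also have "\<dots> = (\<integral>\<^sup>+ q. (\<integral>\<^sup>+ y. ?c q * (ennreal (b ^ znorm y) * indicator (up_steps (snd q)) y)
      \<partial>count_space UNIV) \<partial>count_space UNIV)"
    by (rule nn_integral_count_space_nn_integral) auto
  also have "\<dots> \<le> (\<integral>\<^sup>+ q. ?c q * ennreal (4 * b * b ^ znorm (snd q)) \<partial>count_space UNIV)"
  proof (rule nn_integral_mono)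
    fix q :: "(int \<times> int) \<times> (int \<times> int)"
    show "(\<integral>\<^sup>+ y. ?c q * (ennreal (b ^ znorm y) * indicator (up_steps (snd q)) y) \<partial>count_space UNIV)
        \<le> ?c q * ennreal (4 * b * b ^ znorm (snd q))"
      by (subst nn_integral_cmult) (auto intro!: mult_left_mono nn_integral_up_steps_le b)
  qed
  also have "\<dots> = (\<integral>\<^sup>+ x. (\<integral>\<^sup>+ x'. ?c (x, x') * ennreal (4 * b * b ^ znorm x') \<partial>count_space UNIV) \<partial>count_space UNIV)"
    by (subst nn_integral_fst_count_space[symmetric]) simp
  also have "\<dots> = (\<integral>\<^sup>+ x. ennreal (4 * b * up_prob n) * reach n x
      * (\<integral>\<^sup>+ x'. ennreal (b ^ znorm x') * tau p_h x x' \<partial>count_space UNIV) \<partial>count_space UNIV)"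
  proof (intro nn_integral_cong)
    fix x :: "int \<times> int"
    have "?c (x, x') * ennreal (4 * b * b ^ znorm x')
        = ennreal (4 * b * up_prob n) * reach n x * (ennreal (b ^ znorm x') * tau p_h x x')" for x'
      using b up_prob[of n] by (simp add: ennreal_mult mult_ac)
    then show "(\<integral>\<^sup>+ x'. ?c (x, x') * ennreal (4 * b * b ^ znorm x') \<partial>count_space UNIV)
      = ennreal (4 * b * up_prob n) * reach n x * (\<integral>\<^sup>+ x'. ennreal (b ^ znorm x') * tau p_h x x' \<partial>count_space UNIV)"
      by (simp add: nn_integral_cmult)
  qed
  also have "\<dots> \<le> (\<integral>\<^sup>+ x. ennreal (4 * b * up_prob n) * reach n x * (ennreal (b ^ znorm x) * weighted_chi b p_h) \<partial>count_space UNIV)"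
    by (intro nn_integral_mono mult_left_mono weight_tau_le b) simp
  also have "\<dots> = (\<integral>\<^sup>+ x. ennreal (4 * b * up_prob n) * weighted_chi b p_h * (ennreal (b ^ znorm x) * reach n x) \<partial>count_space UNIV)"
    by (simp add: mult_ac)
  also have "\<dots> = ennreal (4 * b * up_prob n) * weighted_chi b p_h * weight b n"
    unfolding weight_def by (rule nn_integral_cmult) simp
  finally show ?thesis .
qed

text \<open>The crude growth rate bounds every upward probability by 1, so it covers good layers
  with \<open>p_g = 1\<close>.\<close>

lemma weight_le_power:
  assumes b: "1 \<le> b" and D: "ennreal (4 * b) * weighted_chi b p_h \<le> ennreal D" "0 \<le> D"
  shows "weight b n \<le> ennreal (D ^ n)"
proof (induction n)
  case 0 then show ?case by (simp add: weight_0)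
next
  case (Suc n)
  have "ennreal (4 * b * up_prob n) \<le> ennreal (4 * b)"
    using b up_prob[of n] by (intro ennreal_leI) (simp add: mult_left_le)
  then have "ennreal (4 * b * up_prob n) * weighted_chi b p_h \<le> ennreal D"
    using D(1) mult_right_mono[of _ _ "weighted_chi b p_h"] by (meson order_trans zero_le)
  with Suc.IH have "ennreal (4 * b * up_prob n) * weighted_chi b p_h * weight b n \<le> ennreal D * ennreal (D ^ n)"
    by (intro mult_mono) auto
  also have "\<dots> = ennreal (D ^ Suc n)" using D(2) by (simp add: ennreal_mult)
  finally show ?case using weight_Suc_le[OF b, of n] by (rule order_trans[rotated])
qed

text \<open>At \<open>b = 1\<close> the growth factor of a bad layer is
  \<open>4 * p_b * chi p_h\<close>, with no loss from the exponential weight.\<close>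

lemma weight_bad_run:
  assumes "\<And>i. i < r \<Longrightarrow> \<eta> (n + i)"
  shows "weight 1 (n + r) \<le> (ennreal (4 * p_b) * chi p_h) ^ r * weight 1 n"
  using assms
proof (induction r)
  case (Suc r)
  have "weight 1 (n + Suc r) \<le> ennreal (4 * p_b) * chi p_h * weight 1 (n + r)"
    using weight_Suc_le[of 1 "n + r"] Suc.prems[of r] by (simp add: up_prob_def weighted_chi_1)
  also have "\<dots> \<le> ennreal (4 * p_b) * chi p_h * ((ennreal (4 * p_b) * chi p_h) ^ r * weight 1 n)"
    by (intro mult_left_mono Suc) (auto intro: Suc.prems)
  finally show ?case by (simp add: mult.assoc)
qed simp

text \<open>Inside the square each site contributes at most 1; outside it the weight is at least
  \<open>b ^ K\<close>. This trades exponential growth in the height for a count that is only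
  quadratic in \<open>K\<close>.\<close>

lemma weight_1_le:
  assumes b: "1 \<le> b"
  shows "weight 1 n \<le> ennreal ((2 * real K + 1)\<^sup>2) + ennreal (1 / b ^ K) * weight b n"
proof -
  let ?B = "{x. znorm x \<le> K}"
  have "weight 1 n \<le> (\<integral>\<^sup>+ x. indicator ?B x + ennreal (1 / b ^ K) * (ennreal (b ^ znorm x) * reach n x) \<partial>count_space UNIV)"
    unfolding weight_def
  proof (rule nn_integral_mono)
    fix x
    show "ennreal (1 ^ znorm x) * reach n x \<le> indicator ?B x + ennreal (1 / b ^ K) * (ennreal (b ^ znorm x) * reach n x)"
    proof (cases "x \<in> ?B")
      case True
      then show ?thesis using reach_le_1[of n x] by (simp add: add_increasing2)
    next
      case False
      then have "1 \<le> 1 / b ^ K * b ^ znorm x"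
        using power_increasing[of K "znorm x" b] b by (simp add: field_simps)
      then have "1 \<le> ennreal (1 / b ^ K) * ennreal (b ^ znorm x)"
        using b by (simp flip: ennreal_mult)
      then have "1 * reach n x \<le> ennreal (1 / b ^ K) * ennreal (b ^ znorm x) * reach n x"
        by (rule mult_right_mono) simp
      then show ?thesis using False by (simp add: mult.assoc)
    qed
  qed
  also have "\<dots> = emeasure (count_space UNIV) ?B + ennreal (1 / b ^ K) * weight b n"
    unfolding weight_def by (subst nn_integral_add) (simp_all add: nn_integral_cmult)
  also have "emeasure (count_space UNIV) ?B = of_nat ((2 * K + 1)\<^sup>2)"
    using finite_znorm_le[of K] by (simp add: card_znorm_le del: of_nat_power)
  also have "\<dots> = ennreal ((2 * real K + 1)\<^sup>2)"
    by (simp only: ennreal_of_nat_eq_real_of_nat of_nat_power of_nat_add of_nat_mult of_nat_numeral of_nat_1)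
  finally show ?thesis .
qed

text \<open>Each horizontal cluster has finite expected size, hence is almost surely finite, and
  there are only countably many pairs \<open>n\<close>, \<open>x\<close>.\<close>

lemma AE_finite_conn:
  assumes "chi p_h < \<infinity>"
  shows "AE \<omega> in E. \<forall>n x. finite {y. layer_conn \<omega> n x y}"
proof -
  have "AE \<omega> in E. finite {y. layer_conn \<omega> n x y}" for n x
  proof -
    have m: "(\<lambda>\<omega>. indicator {y. layer_conn \<omega> n x y} y :: ennreal) \<in> borel_measurable E" for y
      unfolding indicator_def mem_Collect_eq by measurable
    have eq: "(\<integral>\<^sup>+ \<omega>. (\<integral>\<^sup>+ y. indicator {y. layer_conn \<omega> n x y} y \<partial>count_space UNIV) \<partial>E)
        = (\<integral>\<^sup>+ y. (\<integral>\<^sup>+ \<omega>. indicator {y. layer_conn \<omega> n x y} y \<partial>E) \<partial>count_space UNIV)"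
      by (rule nn_integral_count_space_nn_integral) (auto simp: m)
    also have "\<dots> = (\<integral>\<^sup>+ y. tau p_h x y \<partial>count_space UNIV)"
    proof (rule nn_integral_cong)
      fix y
      have "(\<integral>\<^sup>+ \<omega>. indicator {y. layer_conn \<omega> n x y} y \<partial>E) = (\<integral>\<^sup>+ \<omega>. indicator {\<omega> \<in> space E. layer_conn \<omega> n x y} \<omega> \<partial>E)"
        by (intro nn_integral_cong) (auto simp: indicator_def)
      also have "\<dots> = tau p_h x y"
        unfolding emeasure_layer_conn[of n, symmetric] by (intro nn_integral_indicator) measurable
      finally show "(\<integral>\<^sup>+ \<omega>. indicator {y. layer_conn \<omega> n x y} y \<partial>E) = tau p_h x y" .
    qed
    also have "\<dots> \<le> ennreal (1 ^ znorm x) * weighted_chi 1 p_h"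
      using weight_tau_le[of 1 x] by simp
    also have "\<dots> < \<infinity>" using assms by (simp add: weighted_chi_1)
    finally have fin: "(\<integral>\<^sup>+ \<omega>. (\<integral>\<^sup>+ y. indicator {y. layer_conn \<omega> n x y} y \<partial>count_space UNIV) \<partial>E) < \<infinity>" .
    interpret C: sigma_finite_measure "count_space (UNIV :: (int \<times> int) set)"
      by (rule sigma_finite_measure_count_space_countable) simp
    have "(\<lambda>(y, \<omega>). indicator {y. layer_conn \<omega> n x y} y :: ennreal) \<in> borel_measurable (count_space UNIV \<Otimes>\<^sub>M E)"
      by (rule measurable_pair_measure_countable1) (simp_all add: m)
    from measurable_pair_swap[OF this]
    have "(\<lambda>(\<omega>, y). indicator {y. layer_conn \<omega> n x y} y :: ennreal) \<in> borel_measurable (E \<Otimes>\<^sub>M count_space UNIV)"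
      by simp
    then have "(\<lambda>\<omega>. \<integral>\<^sup>+ y. indicator {y. layer_conn \<omega> n x y} y \<partial>count_space UNIV) \<in> borel_measurable E"
      by (rule C.borel_measurable_nn_integral)
    then have "AE \<omega> in E. (\<integral>\<^sup>+ y. indicator {y. layer_conn \<omega> n x y} y \<partial>count_space UNIV) \<noteq> \<infinity>"
      by (rule nn_integral_PInf_AE) (use fin in auto)
    then show ?thesis
      by eventually_elim (auto intro: ccontr)
  qed
  then show ?thesis by (simp add: AE_all_countable)
qed

text \<open>Almost surely no horizontal cluster is infinite, so percolation forces an entry into
  layer \<open>n\<close>; the union bound over entered sites finishes.\<close>

lemma percolates_le_weight:
  assumes "chi p_h < \<infinity>"
  shows "emeasure E {\<omega> \<in> space E. percolates \<omega>} \<le> weight 1 n"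
proof -
  have "emeasure E {\<omega> \<in> space E. percolates \<omega>} \<le> emeasure E {\<omega> \<in> space E. \<exists>x. entered \<omega> n x}"
  proof (rule emeasure_mono_AE)
    show "AE \<omega> in E. \<omega> \<in> {\<omega> \<in> space E. percolates \<omega>} \<longrightarrow> \<omega> \<in> {\<omega> \<in> space E. \<exists>x. entered \<omega> n x}"
      using AE_finite_conn[OF assms] by eventually_elim (use percolates_split in blast)
  qed measurable
  also have "\<dots> \<le> (\<integral>\<^sup>+ x. emeasure E {\<omega> \<in> space E. entered \<omega> n x} \<partial>count_space UNIV)"
    by (rule emeasure_le_nn_integral_union) measurable
  also have "\<dots> = weight 1 n" by (simp add: weight_def reach_def)
  finally show ?thesis .
qed

lemma percolates_le_bad_run:
  assumes chi: "chi p_h < \<infinity>" and b: "1 \<le> b"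
    and D: "ennreal (4 * b) * weighted_chi b p_h \<le> ennreal D" "1 \<le> D" and C: "D \<le> b ^ C"
    and run: "\<And>i. i < r \<Longrightarrow> \<eta> (n + i)" and n: "n \<le> N"
  shows "emeasure E {\<omega> \<in> space E. percolates \<omega>}
    \<le> (ennreal (4 * p_b) * chi p_h) ^ r * ennreal ((2 * real (C * N) + 1)\<^sup>2 + 1)"
proof -
  \<comment> \<open>The square of radius \<open>C * N\<close> absorbs the growth up to height
    \<open>N\<close>, since \<open>D ^ N \<le> b ^ (C * N)\<close>. The remainder outside is at most
    1, the final summand of the bound.\<close>
  have "ennreal (1 / b ^ (C * N)) * weight b n \<le> ennreal (1 / b ^ (C * N)) * ennreal (D ^ N)"
    using weight_le_power[OF b D(1), of n] D(2) n
    by (intro mult_left_mono) (auto intro: order_trans ennreal_leI power_increasing)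
  also have "\<dots> = ennreal (D ^ N / b ^ (C * N))"
    using b D by (simp flip: ennreal_mult)
  also have "\<dots> \<le> ennreal 1"
    using power_mono[OF C, of N] b D(2) by (intro ennreal_leI) (simp add: power_mult)
  finally have "weight 1 n \<le> ennreal ((2 * real (C * N) + 1)\<^sup>2) + ennreal 1"
    using weight_1_le[OF b, of n "C * N"] by (meson add_left_mono order_trans)
  also have "\<dots> = ennreal ((2 * real (C * N) + 1)\<^sup>2 + 1)"
    by (rule ennreal_plus[symmetric]) auto
  finally have w: "weight 1 n \<le> ennreal ((2 * real (C * N) + 1)\<^sup>2 + 1)" .
  have "emeasure E {\<omega> \<in> space E. percolates \<omega>} \<le> weight 1 (n + r)"
    by (rule percolates_le_weight[OF chi])
  also have "\<dots> \<le> (ennreal (4 * p_b) * chi p_h) ^ r * weight 1 n"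
    by (rule weight_bad_run[OF run])
  also have "\<dots> \<le> (ennreal (4 * p_b) * chi p_h) ^ r * ennreal ((2 * real (C * N) + 1)\<^sup>2 + 1)"
    by (intro mult_left_mono w) simp
  finally show ?thesis .
qed

end

section \<open>Runs of bad layers\<close>

text \<open>Looking only at consecutive disjoint blocks, rather than at all runs, makes the trials
  independent.\<close>

definition no_bad_block :: "nat \<Rightarrow> nat \<Rightarrow> (nat \<Rightarrow> bool) \<Rightarrow> bool" where
  "no_bad_block r M \<eta> \<longleftrightarrow> (\<forall>j<M. \<not> (\<forall>i<r. \<eta> (j * r + i)))"

lemma measurable_no_bad_block [measurable]: "Measurable.pred (layer_law \<delta>) (no_bad_block r M)"
  unfolding no_bad_block_def by measurable

lemma emeasure_run:
  assumes "0 \<le> \<delta>" "\<delta> \<le> 1"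
  shows "emeasure (layer_law \<delta>) {\<eta> \<in> space (layer_law \<delta>). \<forall>i<r. \<eta> (n + i)} = ennreal (\<delta> ^ r)"
proof -
  interpret P: product_prob_space "\<lambda>_ :: nat. measure_pmf (bernoulli_pmf \<delta>)" UNIV
    by (rule product_prob_spaceI) (rule prob_space_measure_pmf)
  have "{\<eta>. \<forall>i<r. \<eta> (n + i)} = {\<eta> :: nat \<Rightarrow> bool. \<forall>i\<in>{n..<n + r}. \<eta> i \<in> {True}}"
  proof (intro Collect_cong iffI ballI allI impI)
    fix \<eta> :: "nat \<Rightarrow> bool" and i
    assume "\<forall>i<r. \<eta> (n + i)" "i \<in> {n..<n + r}"
    then show "\<eta> i \<in> {True}" by (auto dest: spec[of _ "i - n"])
  qed auto
  then have "emeasure (layer_law \<delta>) {\<eta> \<in> space (layer_law \<delta>). \<forall>i<r. \<eta> (n + i)}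
    = (\<Prod>i\<in>{n..<n + r}. emeasure (measure_pmf (bernoulli_pmf \<delta>)) {True})"
    using P.emeasure_PiM_Collect[of "{n..<n + r}" "\<lambda>_. {True}"]
    by (simp flip: layer_law_def)
  then show ?thesis
    using assms by (simp add: emeasure_bernoulli_True ennreal_power)
qed

text \<open>The first \<open>M\<close> blocks lie below layer \<open>M * r\<close> and the next
  block starts there, so each new block contributes an independent factor.\<close>

lemma emeasure_no_bad_block:
  assumes "0 \<le> \<delta>" "\<delta> \<le> 1"
  shows "emeasure (layer_law \<delta>) {\<eta> \<in> space (layer_law \<delta>). no_bad_block r M \<eta>} = ennreal ((1 - \<delta> ^ r) ^ M)"
proof (induction M)
  case 0
  then show ?case
    using prob_space.emeasure_space_1[OF prob_space_layer_law] by (simp add: no_bad_block_def)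
next
  case (Suc M)
  interpret prob_space "layer_law \<delta>" by (rule prob_space_layer_law)
  let ?run = "\<lambda>\<eta>. \<forall>i<r. \<eta> (M * r + i)"
  have le: "\<delta> ^ r \<le> 1" using assms by (rule power_le_one)
  have "emeasure (layer_law \<delta>) {\<eta> \<in> space (layer_law \<delta>). ?run \<eta>} = ennreal (\<delta> ^ r)"
    using emeasure_run[OF assms] .
  then have "prob {\<eta> \<in> space (layer_law \<delta>). ?run \<eta>} = \<delta> ^ r"
    using assms by (simp add: emeasure_eq_measure)
  moreover have "{\<eta> \<in> space (layer_law \<delta>). \<not> ?run \<eta>} = space (layer_law \<delta>) - {\<eta> \<in> space (layer_law \<delta>). ?run \<eta>}"
    by blast
  ultimately have not_run: "emeasure (layer_law \<delta>) {\<eta> \<in> space (layer_law \<delta>). \<not> ?run \<eta>} = ennreal (1 - \<delta> ^ r)"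
    by (simp only: emeasure_eq_measure) (subst prob_compl, measurable)
  have "emeasure (layer_law \<delta>) {\<eta> \<in> space (layer_law \<delta>). no_bad_block r M \<eta> \<and> \<not> ?run \<eta>}
    = emeasure (layer_law \<delta>) {\<eta> \<in> space (layer_law \<delta>). no_bad_block r M \<eta>}
      * emeasure (layer_law \<delta>) {\<eta> \<in> space (layer_law \<delta>). \<not> ?run \<eta>}"
    unfolding layer_law_def
  proof (rule emeasure_PiM_conj)
    show "Measurable.pred (\<Pi>\<^sub>M i\<in>UNIV. measure_pmf (bernoulli_pmf \<delta>)) (no_bad_block r M)"
      unfolding layer_law_def[symmetric] by measurable
    show "Measurable.pred (\<Pi>\<^sub>M i\<in>UNIV. measure_pmf (bernoulli_pmf \<delta>)) (\<lambda>\<eta>. \<not> ?run \<eta>)"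
      unfolding layer_law_def[symmetric] by measurable
    show "determined {..<M * r} (no_bad_block r M)"
      unfolding determined_def
    proof (intro allI impI)
      fix \<eta> \<eta>' :: "nat \<Rightarrow> bool"
      assume eq: "\<forall>i\<in>{..<M * r}. \<eta> i = \<eta>' i"
      have "\<eta> (j * r + i) = \<eta>' (j * r + i)" if "j < M" "i < r" for i j
      proof -
        have "j * r + i < Suc j * r" using that by simp
        also have "\<dots> \<le> M * r" using that by (intro mult_le_mono1) simp
        finally show ?thesis using eq by simp
      qed
      then show "no_bad_block r M \<eta> = no_bad_block r M \<eta>'" unfolding no_bad_block_def by simp
    qed
    show "determined {M * r..} (\<lambda>\<eta>. \<not> ?run \<eta>)"
      unfolding determined_def by simp
  qed (auto intro: prob_space_measure_pmf)
  moreover have "no_bad_block r (Suc M) \<eta> \<longleftrightarrow> no_bad_block r M \<eta> \<and> \<not> ?run \<eta>" for \<eta>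
    unfolding no_bad_block_def less_Suc_eq by blast
  ultimately show ?case
    using Suc.IH not_run le by (simp add: ennreal_mult' mult.commute del: space_layer_law)
qed

lemma one_le_chi: "1 \<le> chi p"
proof -
  have "tau p 0 0 = 1"
    using prob_space.emeasure_space_1[OF prob_space_z2_law] by (simp add: tau_def zconn_def)
  then show ?thesis
    unfolding chi_eq using nn_integral_ge_point[of 0 UNIV "tau p 0"] by simp
qed

text \<open>Split the environments by whether one of the first \<open>M\<close> blocks is entirely
  bad. Without such a block bound the conditional probability by 1; with one, the run starts at
  height at most \<open>M * r\<close>.\<close>

lemma percolation_bound:
  fixes \<delta> p_g p_b p_h :: real
  assumes \<delta>: "0 \<le> \<delta>" "\<delta> \<le> 1" and p: "0 \<le> p_b" "p_b \<le> 1" "0 \<le> p_g" "p_g \<le> 1"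
    and chi: "chi p_h < \<infinity>" and b: "1 \<le> b"
    and D: "ennreal (4 * b) * weighted_chi b p_h \<le> ennreal D" "1 \<le> D" and C: "D \<le> b ^ C"
  shows "emeasure (perc_law \<delta> p_g p_b p_h) {x \<in> space (perc_law \<delta> p_g p_b p_h). percolates (snd x)}
    \<le> ennreal ((1 - \<delta> ^ r) ^ M) + (ennreal (4 * p_b) * chi p_h) ^ r * ennreal ((2 * real (C * (M * r)) + 1)\<^sup>2 + 1)"
proof -
  let ?B = "(ennreal (4 * p_b) * chi p_h) ^ r * ennreal ((2 * real (C * (M * r)) + 1)\<^sup>2 + 1)"
  let ?perc = "{x \<in> space (perc_law \<delta> p_g p_b p_h). percolates (snd x)}"
  have sp: "space (perc_law \<delta> p_g p_b p_h) = space (layer_space \<Otimes>\<^sub>M edge_space)"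
    by (rule sets_eq_imp_space_eq) (rule sets_perc_law)
  have slice: "{\<omega> \<in> space edge_space. (\<eta>, \<omega>) \<in> ?perc}
      = {\<omega> \<in> space (edge_law p_g p_b p_h \<eta>). percolates \<omega>}" for \<eta>
    by (auto simp: sp space_edge_law space_pair_measure space_PiM PiE_def)
  have sets: "?perc \<in> sets (layer_space \<Otimes>\<^sub>M edge_space)"
    using percolates_in_sets by (simp only: sets_perc_law)
  have "emeasure (perc_law \<delta> p_g p_b p_h) ?perc
      = (\<integral>\<^sup>+ \<eta>. emeasure (edge_law p_g p_b p_h \<eta>) {\<omega> \<in> space (edge_law p_g p_b p_h \<eta>). percolates \<omega>} \<partial>layer_law \<delta>)"
    by (simp only: emeasure_perc_law[OF sets] slice)
  also have "\<dots> \<le> (\<integral>\<^sup>+ \<eta>. indicator {\<eta> \<in> space (layer_law \<delta>). no_bad_block r M \<eta>} \<eta> + ?B \<partial>layer_law \<delta>)"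
  proof (rule nn_integral_mono)
    fix \<eta> assume \<eta>: "\<eta> \<in> space (layer_law \<delta>)"
    interpret environment p_g p_b p_h \<eta> by standard (use p in auto)
    show "emeasure E {\<omega> \<in> space E. percolates \<omega>} \<le> indicator {\<eta> \<in> space (layer_law \<delta>). no_bad_block r M \<eta>} \<eta> + ?B"
    proof (cases "no_bad_block r M \<eta>")
      case True
      have "emeasure E {\<omega> \<in> space E. percolates \<omega>} \<le> 1" by (rule emeasure_le_1)
      also have "\<dots> \<le> 1 + ?B" by simp
      finally show ?thesis using True \<eta> by simp
    next
      case False
      then obtain j where j: "j < M" "\<And>i. i < r \<Longrightarrow> \<eta> (j * r + i)" unfolding no_bad_block_def by blast
      have "emeasure E {\<omega> \<in> space E. percolates \<omega>} \<le> ?B"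
        by (rule percolates_le_bad_run[OF chi b D C j(2)]) (use j(1) in auto)
      then show ?thesis using False by simp
    qed
  qed
  also have "\<dots> = emeasure (layer_law \<delta>) {\<eta> \<in> space (layer_law \<delta>). no_bad_block r M \<eta>} + ?B"
    using prob_space.emeasure_space_1[OF prob_space_layer_law, of \<delta>]
    by (subst nn_integral_add) (simp_all del: space_layer_law)
  also have "\<dots> = ennreal ((1 - \<delta> ^ r) ^ M) + ?B"
    by (simp only: emeasure_no_bad_block[OF \<delta>])
  finally show ?thesis .
qed

text \<open>\<open>M\<close> must exceed \<delta>^(-r), so that a bad block is likely, yet
  \<open>M^2\<close> must be beaten by (\<delta>^2/4)^r, so \<open>M\<close> must stay below
  (2/\<delta>)^r. Any base strictly between 1/\<delta> and 2/\<delta> achieves both; 3/(2\<delta>)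
  is one.\<close>

lemma bound_choice:
  fixes \<delta> C :: real and r :: nat
  assumes \<delta>: "0 < \<delta>" "\<delta> \<le> 1" and C: "0 \<le> C"
  defines "M \<equiv> nat \<lceil>(3 / (2 * \<delta>)) ^ r\<rceil>"
  shows "(1 - \<delta> ^ r) ^ M \<le> exp (- ((3 / 2) ^ r))"
    and "(\<delta>\<^sup>2 / 4) ^ r * ((2 * (C * (real M * real r)) + 1)\<^sup>2 + 1) \<le> (9 / 16) ^ r * ((4 * C * real r + 1)\<^sup>2 + 1)"
proof -
  define X where "X = (3 / (2 * \<delta>)) ^ r"
  have X1: "1 \<le> X" unfolding X_def using \<delta> by (intro one_le_power) (simp add: field_simps)
  \<comment> \<open>Rounding up at most doubles \<open>X\<close>, because \<open>X\<close> is at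
    least 1.\<close>
  have M: "X \<le> real M" "real M \<le> 2 * X"
    using X1 unfolding M_def X_def[symmetric] by linarith+
  have X\<delta>: "X * \<delta> ^ r = (3 / 2) ^ r"
    using \<delta> by (simp add: X_def flip: power_mult_distrib)
  have d1: "\<delta> ^ r \<le> 1" using \<delta> by (intro power_le_one) auto
  have "(1 - \<delta> ^ r) ^ M \<le> exp (- (\<delta> ^ r)) ^ M"
    using exp_ge_add_one_self[of "- (\<delta> ^ r)"] d1 by (intro power_mono) auto
  also have "\<dots> = exp (- (real M * \<delta> ^ r))" by (simp flip: exp_of_nat_mult)
  also have "\<dots> \<le> exp (- ((3 / 2) ^ r))"
    using mult_right_mono[OF M(1), of "\<delta> ^ r"] \<delta> X\<delta> by simp
  finally show "(1 - \<delta> ^ r) ^ M \<le> exp (- ((3 / 2) ^ r))" .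
  have "2 * (C * (real M * real r)) + 1 \<le> 2 * (C * (2 * X * real r)) + 1"
    using M C by (intro add_right_mono mult_left_mono mult_right_mono) auto
  also have "\<dots> \<le> X * (4 * C * real r + 1)" using X1 by (simp add: algebra_simps)
  finally have "(2 * (C * (real M * real r)) + 1)\<^sup>2 \<le> (X * (4 * C * real r + 1))\<^sup>2"
    using C by (intro power_mono) auto
  then have "(2 * (C * (real M * real r)) + 1)\<^sup>2 \<le> X\<^sup>2 * (4 * C * real r + 1)\<^sup>2"
    by (simp only: power_mult_distrib)
  moreover have "1 \<le> X\<^sup>2" using X1 by (rule one_le_power)
  ultimately have "(2 * (C * (real M * real r)) + 1)\<^sup>2 + 1 \<le> X\<^sup>2 * ((4 * C * real r + 1)\<^sup>2 + 1)"
    by (simp only: distrib_left mult_1_right add_mono)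
  then have "(\<delta>\<^sup>2 / 4) ^ r * ((2 * (C * (real M * real r)) + 1)\<^sup>2 + 1)
      \<le> (\<delta>\<^sup>2 / 4) ^ r * (X\<^sup>2 * ((4 * C * real r + 1)\<^sup>2 + 1))"
    by (intro mult_left_mono) auto
  also have "(\<delta>\<^sup>2 / 4) ^ r * (X\<^sup>2 * ((4 * C * real r + 1)\<^sup>2 + 1)) = (9 / 16) ^ r * ((4 * C * real r + 1)\<^sup>2 + 1)"
  proof -
    have "(\<delta>\<^sup>2 / 4) ^ r * X\<^sup>2 = (\<delta>\<^sup>2 / 4 * (3 / (2 * \<delta>))\<^sup>2) ^ r"
      unfolding X_def by (simp only: power_mult_distrib power_mult[symmetric] mult.commute)
    also have "\<delta>\<^sup>2 / 4 * (3 / (2 * \<delta>))\<^sup>2 = 9 / 16"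
      using \<delta> by (simp add: field_simps power2_eq_square)
    finally show ?thesis by (simp add: mult.assoc[symmetric])
  qed
  finally show "(\<delta>\<^sup>2 / 4) ^ r * ((2 * (C * (real M * real r)) + 1)\<^sup>2 + 1) \<le> \<dots>" .
qed

theorem theorem1:
  fixes \<delta> p_g p_b p_h :: real
  assumes "0 < \<delta>" and "\<delta> \<le> 1"
    and "0 \<le> p_h" and "p_h < 1 / 2"
    and "0 < p_b" and "ennreal p_b < ennreal (\<delta>\<^sup>2) / (16 * chi p_h)"
    and "p_b \<le> p_g" and "p_g \<le> 1"
  shows "measure (perc_law \<delta> p_g p_b p_h)
    {x \<in> space (perc_law \<delta> p_g p_b p_h). percolates (snd x)} = 0"
proof -
  let ?P = "perc_law \<delta> p_g p_b p_h"
  let ?A = "{x \<in> space ?P. percolates (snd x)}"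
  interpret prob_space ?P by (rule prob_space_perc_law)
  \<comment> \<open>An infinite susceptibility would make the threshold \<delta>^2/\<infinity> = 0,
    and nothing is strictly below 0 in \<open>ennreal\<close>.\<close>
  have fin: "chi p_h < \<infinity>"
  proof (rule ccontr)
    assume "\<not> ?thesis"
    then have "chi p_h = \<infinity>" using less_top[of "chi p_h"] by auto
    then show False using assms(6) by (simp add: ennreal_mult_top)
  qed
  then obtain k where k: "chi p_h = ennreal k" "0 \<le> k" by (cases "chi p_h") auto
  have "1 \<le> k" using one_le_chi[of p_h] k by simp
  have "ennreal (\<delta>\<^sup>2) / (16 * chi p_h) = ennreal (\<delta>\<^sup>2 / (16 * k))"
  proof -
    have "16 * chi p_h = ennreal (16 * k)" using k by (simp add: ennreal_mult)
    then show ?thesis using \<open>1 \<le> k\<close> by (simp add: divide_ennreal)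
  qed
  then have "p_b < \<delta>\<^sup>2 / (16 * k)" using assms(5,6) by (simp add: ennreal_less_iff)
  \<comment> \<open>The 16 of the threshold is used here: one factor 4 counts the upward edges of a
    site, the other makes the bad-layer factor small against the squared height of the run.\<close>
  then have q: "4 * p_b * k \<le> \<delta>\<^sup>2 / 4" using \<open>1 \<le> k\<close> by (simp add: field_simps)
  obtain b where b: "1 < b" "weighted_chi b p_h < \<infinity>" using ex_weighted_chi_finite[OF fin] by blast
  obtain w where w: "weighted_chi b p_h = ennreal w" "0 \<le> w" using b(2) by (cases "weighted_chi b p_h") auto
  \<comment> \<open>The maximum with 1 makes the powers of \<open>D\<close> nondecreasing in the
    height.\<close>
  define D where "D = max 1 (4 * b * w)"
  have D: "ennreal (4 * b) * weighted_chi b p_h \<le> ennreal D" "1 \<le> D"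
    using b w by (auto simp: D_def ennreal_mult[symmetric])
  obtain C where C: "D < b ^ C" using real_arch_pow[OF b(1)] by blast
  let ?f = "\<lambda>r. exp (- ((3 / 2) ^ r)) + (9 / 16) ^ r * ((4 * real C * real r + 1)\<^sup>2 + 1)"
  have bound: "prob ?A \<le> ?f r" for r
  proof -
    define M where "M = nat \<lceil>(3 / (2 * \<delta>)) ^ r\<rceil>"
    have "(4 * p_b * k) ^ r * ((2 * real (C * (M * r)) + 1)\<^sup>2 + 1)
        \<le> (\<delta>\<^sup>2 / 4) ^ r * ((2 * real (C * (M * r)) + 1)\<^sup>2 + 1)"
      using q assms(5) k(2) by (intro mult_right_mono power_mono) auto
    also have "\<dots> \<le> (9 / 16) ^ r * ((4 * real C * real r + 1)\<^sup>2 + 1)"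
      using bound_choice(2)[of \<delta> "real C" r] assms(1,2) by (simp add: M_def)
    finally have 2: "(4 * p_b * k) ^ r * ((2 * real (C * (M * r)) + 1)\<^sup>2 + 1) \<le> \<dots>" .
    have 1: "(1 - \<delta> ^ r) ^ M \<le> exp (- ((3 / 2) ^ r))"
      unfolding M_def using assms(1,2) by (rule bound_choice(1)[where C = 0]) simp
    have d1: "0 \<le> 1 - \<delta> ^ r" using assms(1,2) by (simp add: power_le_one)
    have "emeasure ?P ?A \<le> ennreal ((1 - \<delta> ^ r) ^ M)
        + (ennreal (4 * p_b) * chi p_h) ^ r * ennreal ((2 * real (C * (M * r)) + 1)\<^sup>2 + 1)"
      by (rule percolation_bound[OF _ _ _ _ _ _ fin _ D]) (use assms b C in auto)
    also have "\<dots> = ennreal ((1 - \<delta> ^ r) ^ M + (4 * p_b * k) ^ r * ((2 * real (C * (M * r)) + 1)\<^sup>2 + 1))"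
      using assms(5) k d1 by (simp add: ennreal_mult[symmetric] ennreal_power ennreal_plus[symmetric] del: ennreal_plus)
    also have "\<dots> \<le> ennreal (?f r)"
      using 1 2 by (intro ennreal_leI add_mono)
    finally have "ennreal (prob ?A) \<le> ennreal (?f r)" by (simp only: emeasure_eq_measure)
    then show ?thesis by (subst (asm) ennreal_le_iff) auto
  qed
  have "?f \<longlonglongrightarrow> 0"
  proof -
    have lim: "(\<lambda>r. exp (- ((3 / 2) ^ r)) :: real) \<longlonglongrightarrow> 0" "(\<lambda>r. (9 / 16) ^ r :: real) \<longlonglongrightarrow> 0"
      "(\<lambda>r. real r * (9 / 16) ^ r) \<longlonglongrightarrow> 0" "(\<lambda>r. (real r)\<^sup>2 * (9 / 16) ^ r) \<longlonglongrightarrow> 0"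
      by real_asymp+
    \<comment> \<open>The square is expanded: (4Cr + 1)^2 + 1 = 16 C^2 r^2 + 8Cr + 2.\<close>
    have "(\<lambda>r. exp (- ((3 / 2) ^ r)) + (16 * (real C)\<^sup>2 * ((real r)\<^sup>2 * (9 / 16) ^ r)
        + 8 * real C * (real r * (9 / 16) ^ r) + 2 * (9 / 16) ^ r))
      \<longlonglongrightarrow> 0 + (16 * (real C)\<^sup>2 * 0 + 8 * real C * 0 + 2 * 0)"
      by (intro tendsto_add tendsto_mult tendsto_const lim)
    then show ?thesis by (simp add: power2_eq_square algebra_simps)
  qed
  then have "prob ?A \<le> 0" by (rule LIMSEQ_le_const) (use bound in blast)
  then show ?thesis using measure_nonneg[of ?P ?A] by linarith
qed

end
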